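(* Let $(M=G/K,\mathfrak{m}_{1}\oplus\mathfrak{m}_{2},g_{1/2})$ be a compact connected homogeneous Riemannian manifold with two isotropy summands satisfying $[\mathfrak{k},\mathfrak{m}_i]\subset\mathfrak{m}_i$, $[\mathfrak{m}_1,\mathfrak{m}_1]\subset\mathfrak{k}\oplus\mathfrak{m}_2$, $[\mathfrak{m}_1,\mathfrak{m}_2]\subset\mathfrak{m}_1$, $[\mathfrak{m}_2,\mathfrak{m}_2]\subset\mathfrak{k}$. Then $M=G/K$ is a $\nabla^{s}$-Einstein manifold with skew-torsion $0\neq T^{s}\in\Lambda^{3}(\mathfrak{m})$ for the values $s=0$ or $s=2$ if and only if the Killing metric $g_{B}\equiv g_{1/2}$ is a $G$-invariant Einstein metric, i.e. $\mathrm{Cas}_1=\mathrm{Cas}_2$.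
   Context: $G$ is a compact connected semisimple Lie group, $K\subset G$ a closed connected subgroup, with Lie algebras $\mathfrak{g},\mathfrak{k}$; $B$ is the negative of the Killing form of $\mathfrak{g}$; $\mathfrak{g}=\mathfrak{k}\oplus\mathfrak{m}$ is the $B$-orthogonal reductive decomposition, $\mathfrak{m}\cong T_oM$, $n=\dim M\geq 3$. "Two isotropy summands" means $\mathfrak{m}=\mathfrak{m}_1\oplus\mathfrak{m}_2$ is a $B$-orthogonal decomposition into two non-trivial, irreducible, inequivalent $\mathrm{Ad}(K)$-submodules. The metric $g_{1/2}=g_B$ is the $G$-invariant (Killing) metric induced by $B|_{\mathfrak{m}\times\mathfrak{m}}$. A $G$-invariant connection corresponds to its Nomizu map $\Lambda:\mathfrak{m}\to\mathfrak{gl}(\mathfrak{m})$, with torsion $T(X,Y)=\Lambda(X)Y-\Lambda(Y)X-[X,Y]_{\mathfrak{m}}$ and curvature $R(X,Y)=[\Lambda(X),\Lambda(Y)]-\Lambda([X,Y]_{\mathfrak{m}})-\mathrm{ad}([X,Y]_{\mathfrak{k}})$. For $s\in\mathbb{R}$, $\nabla^s$ is the $G$-invariant metric connection whose Nomizu map is $s$ times the Nomizu map of the Levi-Civita connection of $g_{1/2}$, i.e. $\Lambda_s(X)Y=\frac{s}{2}[X,Y]_{\mathfrak{m}}$; its torsion is $T^s(X,Y)=(s-1)[X,Y]_{\mathfrak{m}}$, which for $g_{1/2}$ is a 3-form. $(M,g,\nabla)$, with $\nabla$ a metric connection with totally skew torsion, is $\nabla$-Einstein if $\mathrm{Ric}_S=\frac{\mathrm{Scal}}{n}g$,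 where $\mathrm{Ric}_S$ is the symmetric part of the Ricci tensor $\mathrm{Ric}(X,Y)=\sum_i g(R(X,e_i)e_i,Y)$ of $\nabla$ and $\mathrm{Scal}$ its scalar curvature; $\nabla^s$-Einstein means this for $\nabla=\nabla^s$, $g=g_{1/2}$. $\mathrm{Cas}_i>0$ are the Casimir constants: with $\chi^i_*(Y)=\mathrm{ad}(Y)|_{\mathfrak{m}_i}$ for $Y\in\mathfrak{k}$ and $\{k_a,k_a'\}$ dual bases of $\mathfrak{k}$ with respect to $B|_{\mathfrak{k}\times\mathfrak{k}}$, one has $-\sum_a\chi^i_*(k_a)\circ\chi^i_*(k_a')=\mathrm{Cas}_i\cdot\mathrm{Id}_{\mathfrak{m}_i}$.
   Formalization: The equivalence with ∇^s-Einstein is claimed only when [m,m]_m ≠ 0, since otherwise T^s = 0 while the Killing metric is Einstein (e.g. S²×S³); G is taken as a compact matrix group, which covers all compact Lie groups up to isomorphism. *)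

theory Defs
  imports "HOL-Analysis.Analysis"
begin

text \<open>
  Compact Lie groups are realised as compact subgroups of $GL(N,\mathbb{R})$, with \<open>N = CARD('n)\<close>
  arbitrary.  By the Peter-Weyl theorem every compact Lie group is isomorphic to such a group, and
  by Cartan's theorem every closed subgroup of such a group is a Lie group.
\<close>

type_synonym 'n mat = "real ^ 'n ^ 'n"

definition matrix_group :: "'n::finite mat set \<Rightarrow> bool" where
  "matrix_group G \<longleftrightarrow> mat 1 \<in> G \<and> (\<forall>A\<in>G. \<forall>B\<in>G. A ** B \<in> G) \<and>
     (\<forall>A\<in>G. invertible A \<and> matrix_inv A \<in> G)"

text \<open>The tangent space at the identity: velocities of differentiable curves in \<open>G\<close>.\<close>

definition lie_algebra :: "'n::finite mat set \<Rightarrow> 'n mat set" where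
  "lie_algebra G = {X. \<exists>\<gamma> :: real \<Rightarrow> 'n mat. (\<forall>t. \<gamma> t \<in> G \<and> \<gamma> differentiable (at t)) \<and>
     \<gamma> 0 = mat 1 \<and> (\<gamma> has_vector_derivative X) (at 0)}"

definition bracket :: "'n::finite mat \<Rightarrow> 'n mat \<Rightarrow> 'n mat" where
  "bracket X Y = X ** Y - Y ** X"

definition Ad :: "'n::finite mat \<Rightarrow> 'n mat \<Rightarrow> 'n mat" where
  "Ad A X = A ** X ** matrix_inv A"

subsection \<open>Semisimplicity and the Killing form\<close>

definition lie_ideal :: "'n::finite mat set \<Rightarrow> 'n mat set \<Rightarrow> bool" where
  "lie_ideal L I \<longleftrightarrow> subspace I \<and> I \<subseteq> L \<and> (\<forall>X\<in>L. \<forall>Y\<in>I. bracket X Y \<in> I)"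

fun derived_series :: "'n::finite mat set \<Rightarrow> nat \<Rightarrow> 'n mat set" where
  "derived_series I 0 = I"
| "derived_series I (Suc j) =
     span {bracket X Y | X Y. X \<in> derived_series I j \<and> Y \<in> derived_series I j}"

definition solvable_lie :: "'n::finite mat set \<Rightarrow> bool" where
  "solvable_lie I \<longleftrightarrow> (\<exists>j. derived_series I j = {0})"

definition semisimple_lie :: "'n::finite mat set \<Rightarrow> bool" where
  "semisimple_lie L \<longleftrightarrow> (\<forall>I. lie_ideal L I \<and> solvable_lie I \<longrightarrow> I = {0})"

definition basis_of :: "'a::real_vector set \<Rightarrow> 'a set" where
  "basis_of S = (SOME E. independent E \<and> span E = S)"

text \<open>Trace of an endomorphism \<open>f\<close> of the subspace \<open>S\<close>: the sum of the diagonal coefficients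
  of \<open>f\<close> in a basis of \<open>S\<close>.\<close>

definition trace_on :: "'a::real_vector set \<Rightarrow> ('a \<Rightarrow> 'a) \<Rightarrow> real" where
  "trace_on S f = (\<Sum>e\<in>basis_of S. representation (basis_of S) (f e) e)"

definition killing_form :: "'n::finite mat set \<Rightarrow> 'n mat \<Rightarrow> 'n mat \<Rightarrow> real" where
  "killing_form L X Y = trace_on L (\<lambda>Z. bracket X (bracket Y Z))"

text \<open>The form \<open>B\<close>; its restriction to the reductive complement is the Killing metric.\<close>

definition neg_killing :: "'n::finite mat set \<Rightarrow> 'n mat \<Rightarrow> 'n mat \<Rightarrow> real" where
  "neg_killing G X Y = - killing_form (lie_algebra G) X Y"

subsection \<open>The reductive decomposition\<close>

text \<open>The \<open>B\<close>-orthogonal complement of the Lie algebra of \<open>K\<close> in that of \<open>G\<close>.\<close>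

definition tangent_space :: "'n::finite mat set \<Rightarrow> 'n mat set \<Rightarrow> 'n mat set" where
  "tangent_space G K =
     {X \<in> lie_algebra G. \<forall>Y\<in>lie_algebra K. neg_killing G X Y = 0}"

text \<open>The component in \<open>U\<close> of an element of \<open>U \<oplus> V\<close>.\<close>

definition component :: "'a::real_vector set \<Rightarrow> 'a set \<Rightarrow> 'a \<Rightarrow> 'a" where
  "component U V X = (THE Z. Z \<in> U \<and> X - Z \<in> V)"

definition bracket_m :: "'n::finite mat set \<Rightarrow> 'n mat set \<Rightarrow> 'n mat \<Rightarrow> 'n mat \<Rightarrow> 'n mat" where
  "bracket_m G K X Y = component (tangent_space G K) (lie_algebra K) (bracket X Y)"

definition bracket_k :: "'n::finite mat set \<Rightarrow> 'n mat set \<Rightarrow> 'n mat \<Rightarrow> 'n mat \<Rightarrow> 'n mat" where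
  "bracket_k G K X Y = component (lie_algebra K) (tangent_space G K) (bracket X Y)"

definition linear_map_on :: "'a::real_vector set \<Rightarrow> ('a \<Rightarrow> 'b::real_vector) \<Rightarrow> bool" where
  "linear_map_on S f \<longleftrightarrow>
     (\<forall>x\<in>S. \<forall>y\<in>S. \<forall>a b. f (a *\<^sub>R x + b *\<^sub>R y) = a *\<^sub>R f x + b *\<^sub>R f y)"

definition submodule :: "'n::finite mat set \<Rightarrow> 'n mat set \<Rightarrow> bool" where
  "submodule K V \<longleftrightarrow> subspace V \<and> (\<forall>A\<in>K. \<forall>X\<in>V. Ad A X \<in> V)"

definition irreducible_module :: "'n::finite mat set \<Rightarrow> 'n mat set \<Rightarrow> bool" where
  "irreducible_module K V \<longleftrightarrow> submodule K V \<and> V \<noteq> {0} \<and>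
     (\<forall>W. submodule K W \<and> W \<subseteq> V \<longrightarrow> W = {0} \<or> W = V)"

definition equivalent_modules :: "'n::finite mat set \<Rightarrow> 'n mat set \<Rightarrow> 'n mat set \<Rightarrow> bool" where
  "equivalent_modules K V W \<longleftrightarrow>
     (\<exists>f. linear_map_on V f \<and> bij_betw f V W \<and> (\<forall>A\<in>K. \<forall>X\<in>V. f (Ad A X) = Ad A (f X)))"

text \<open>Orthogonality makes the sum of \<open>m1\<close> and \<open>m2\<close> direct, since \<open>B\<close> is positive definite.\<close>

definition two_isotropy_summands ::
    "'n::finite mat set \<Rightarrow> 'n mat set \<Rightarrow> 'n mat set \<Rightarrow> 'n mat set \<Rightarrow> bool" where
  "two_isotropy_summands G K m1 m2 \<longleftrightarrow>
     tangent_space G K = {X + Y | X Y. X \<in> m1 \<and> Y \<in> m2} \<and>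
     (\<forall>X\<in>m1. \<forall>Y\<in>m2. neg_killing G X Y = 0) \<and>
     irreducible_module K m1 \<and> irreducible_module K m2 \<and> \<not> equivalent_modules K m1 m2"

subsection \<open>Invariant metrics and connections\<close>

definition invariant_metric ::
    "'n::finite mat set \<Rightarrow> 'n mat set \<Rightarrow> ('n mat \<Rightarrow> 'n mat \<Rightarrow> real) \<Rightarrow> bool" where
  "invariant_metric G K g \<longleftrightarrow> (let m = tangent_space G K in
     (\<forall>X\<in>m. linear_map_on m (g X)) \<and>
     (\<forall>X\<in>m. \<forall>Y\<in>m. g X Y = g Y X) \<and>
     (\<forall>X\<in>m. X \<noteq> 0 \<longrightarrow> g X X > 0) \<and>
     (\<forall>A\<in>K. \<forall>X\<in>m. \<forall>Y\<in>m. g (Ad A X) (Ad A Y) = g X Y))"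

text \<open>Nomizu maps of invariant connections are the linear \<open>Ad(K)\<close>-equivariant maps
  from \<open>m\<close> to $\mathfrak{gl}(m)$; the values outside \<open>m\<close> are irrelevant.\<close>

definition nomizu_map ::
    "'n::finite mat set \<Rightarrow> 'n mat set \<Rightarrow> ('n mat \<Rightarrow> 'n mat \<Rightarrow> 'n mat) \<Rightarrow> bool" where
  "nomizu_map G K \<Lambda> \<longleftrightarrow> (let m = tangent_space G K in
     (\<forall>X\<in>m. \<forall>Y\<in>m. \<Lambda> X Y \<in> m) \<and>
     (\<forall>X\<in>m. linear_map_on m (\<Lambda> X)) \<and>
     (\<forall>Y\<in>m. linear_map_on m (\<lambda>X. \<Lambda> X Y)) \<and>
     (\<forall>A\<in>K. \<forall>X\<in>m. \<forall>Y\<in>m. \<Lambda> (Ad A X) (Ad A Y) = Ad A (\<Lambda> X Y)))"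

definition metric_connection ::
    "'n::finite mat set \<Rightarrow> 'n mat set \<Rightarrow> ('n mat \<Rightarrow> 'n mat \<Rightarrow> real) \<Rightarrow>
      ('n mat \<Rightarrow> 'n mat \<Rightarrow> 'n mat) \<Rightarrow> bool" where
  "metric_connection G K g \<Lambda> \<longleftrightarrow> nomizu_map G K \<Lambda> \<and> (let m = tangent_space G K in
     \<forall>X\<in>m. \<forall>Y\<in>m. \<forall>Z\<in>m. g (\<Lambda> X Y) Z + g Y (\<Lambda> X Z) = 0)"

definition torsion ::
    "'n::finite mat set \<Rightarrow> 'n mat set \<Rightarrow> ('n mat \<Rightarrow> 'n mat \<Rightarrow> 'n mat) \<Rightarrow>
      'n mat \<Rightarrow> 'n mat \<Rightarrow> 'n mat" where
  "torsion G K \<Lambda> X Y = \<Lambda> X Y - \<Lambda> Y X - bracket_m G K X Y"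

definition curvature ::
    "'n::finite mat set \<Rightarrow> 'n mat set \<Rightarrow> ('n mat \<Rightarrow> 'n mat \<Rightarrow> 'n mat) \<Rightarrow>
      'n mat \<Rightarrow> 'n mat \<Rightarrow> 'n mat \<Rightarrow> 'n mat" where
  "curvature G K \<Lambda> X Y Z =
     \<Lambda> X (\<Lambda> Y Z) - \<Lambda> Y (\<Lambda> X Z) - \<Lambda> (bracket_m G K X Y) Z - bracket (bracket_k G K X Y) Z"

definition orthonormal_basis :: "('a::real_vector \<Rightarrow> 'a \<Rightarrow> real) \<Rightarrow> 'a set \<Rightarrow> 'a set" where
  "orthonormal_basis g S = (SOME E. independent E \<and> span E = S \<and>
     (\<forall>e\<in>E. \<forall>f\<in>E. g e f = (if e = f then 1 else 0)))"

definition ricci ::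
    "'n::finite mat set \<Rightarrow> 'n mat set \<Rightarrow> ('n mat \<Rightarrow> 'n mat \<Rightarrow> real) \<Rightarrow>
      ('n mat \<Rightarrow> 'n mat \<Rightarrow> 'n mat) \<Rightarrow> 'n mat \<Rightarrow> 'n mat \<Rightarrow> real" where
  "ricci G K g \<Lambda> X Y =
     (\<Sum>e\<in>orthonormal_basis g (tangent_space G K). g (curvature G K \<Lambda> X e e) Y)"

definition ricci_sym ::
    "'n::finite mat set \<Rightarrow> 'n mat set \<Rightarrow> ('n mat \<Rightarrow> 'n mat \<Rightarrow> real) \<Rightarrow>
      ('n mat \<Rightarrow> 'n mat \<Rightarrow> 'n mat) \<Rightarrow> 'n mat \<Rightarrow> 'n mat \<Rightarrow> real" where
  "ricci_sym G K g \<Lambda> X Y = (ricci G K g \<Lambda> X Y + ricci G K g \<Lambda> Y X) / 2"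

definition scal ::
    "'n::finite mat set \<Rightarrow> 'n mat set \<Rightarrow> ('n mat \<Rightarrow> 'n mat \<Rightarrow> real) \<Rightarrow>
      ('n mat \<Rightarrow> 'n mat \<Rightarrow> 'n mat) \<Rightarrow> real" where
  "scal G K g \<Lambda> = (\<Sum>e\<in>orthonormal_basis g (tangent_space G K). ricci G K g \<Lambda> e e)"

definition three_form_on ::
    "'a::real_vector set \<Rightarrow> ('a \<Rightarrow> 'a \<Rightarrow> 'a \<Rightarrow> real) \<Rightarrow> bool" where
  "three_form_on S \<omega> \<longleftrightarrow> (\<forall>X\<in>S. \<forall>Y\<in>S.
     linear_map_on S (\<omega> X Y) \<and> (\<forall>Z\<in>S. \<omega> Y X Z = - \<omega> X Y Z \<and> \<omega> X Z Y = - \<omega> X Y Z))"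

definition skew_torsion ::
    "'n::finite mat set \<Rightarrow> 'n mat set \<Rightarrow> ('n mat \<Rightarrow> 'n mat \<Rightarrow> real) \<Rightarrow>
      ('n mat \<Rightarrow> 'n mat \<Rightarrow> 'n mat) \<Rightarrow> bool" where
  "skew_torsion G K g \<Lambda> \<longleftrightarrow>
     three_form_on (tangent_space G K) (\<lambda>X Y Z. g (torsion G K \<Lambda> X Y) Z)"

definition nonzero_torsion ::
    "'n::finite mat set \<Rightarrow> 'n mat set \<Rightarrow> ('n mat \<Rightarrow> 'n mat \<Rightarrow> 'n mat) \<Rightarrow> bool" where
  "nonzero_torsion G K \<Lambda> \<longleftrightarrow>
     (\<exists>X\<in>tangent_space G K. \<exists>Y\<in>tangent_space G K. torsion G K \<Lambda> X Y \<noteq> 0)"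

definition nabla_einstein ::
    "'n::finite mat set \<Rightarrow> 'n mat set \<Rightarrow> ('n mat \<Rightarrow> 'n mat \<Rightarrow> real) \<Rightarrow>
      ('n mat \<Rightarrow> 'n mat \<Rightarrow> 'n mat) \<Rightarrow> bool" where
  "nabla_einstein G K g \<Lambda> \<longleftrightarrow>
     invariant_metric G K g \<and> metric_connection G K g \<Lambda> \<and> skew_torsion G K g \<Lambda> \<and>
     (let m = tangent_space G K in \<forall>X\<in>m. \<forall>Y\<in>m.
        ricci_sym G K g \<Lambda> X Y = scal G K g \<Lambda> / real (dim m) * g X Y)"

definition levi_civita ::
    "'n::finite mat set \<Rightarrow> 'n mat set \<Rightarrow> ('n mat \<Rightarrow> 'n mat \<Rightarrow> real) \<Rightarrow>
      ('n mat \<Rightarrow> 'n mat \<Rightarrow> 'n mat) \<Rightarrow> bool" where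
  "levi_civita G K g \<Lambda> \<longleftrightarrow> metric_connection G K g \<Lambda> \<and> \<not> nonzero_torsion G K \<Lambda>"

definition invariant_einstein_metric ::
    "'n::finite mat set \<Rightarrow> 'n mat set \<Rightarrow> ('n mat \<Rightarrow> 'n mat \<Rightarrow> real) \<Rightarrow> bool" where
  "invariant_einstein_metric G K g \<longleftrightarrow> invariant_metric G K g \<and>
     (\<exists>\<Lambda>. levi_civita G K g \<Lambda> \<and> (\<exists>c. \<forall>X\<in>tangent_space G K. \<forall>Y\<in>tangent_space G K.
        ricci G K g \<Lambda> X Y = c * g X Y))"

text \<open>The Nomizu map of $\nabla^s$: \<open>s\<close> times that of the Levi-Civita connection of the
  Killing metric.\<close>

definition nabla_s ::
    "'n::finite mat set \<Rightarrow> 'n mat set \<Rightarrow> real \<Rightarrow> 'n mat \<Rightarrow> 'n mat \<Rightarrow> 'n mat" where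
  "nabla_s G K s X Y = (s / 2) *\<^sub>R bracket_m G K X Y"

subsection \<open>Casimir constants\<close>

text \<open>The member, paired with \<open>e\<close>, of the basis of \<open>S\<close> that is \<open>b\<close>-dual to the basis \<open>E\<close>.\<close>

definition dual_vector :: "('a::real_vector \<Rightarrow> 'a \<Rightarrow> real) \<Rightarrow> 'a set \<Rightarrow> 'a set \<Rightarrow> 'a \<Rightarrow> 'a" where
  "dual_vector b S E e = (THE d. d \<in> S \<and> (\<forall>f\<in>E. b f d = (if f = e then 1 else 0)))"

definition casimir_operator ::
    "'n::finite mat set \<Rightarrow> 'n mat set \<Rightarrow> 'n mat \<Rightarrow> 'n mat" where
  "casimir_operator G K X = (let L = lie_algebra K; E = basis_of L in
     - (\<Sum>e\<in>E. bracket e (bracket (dual_vector (neg_killing G) L E e) X)))"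

text \<open>Uniquely determined when \<open>V\<close> is an irreducible summand of the isotropy representation.\<close>

definition casimir_constant ::
    "'n::finite mat set \<Rightarrow> 'n mat set \<Rightarrow> 'n mat set \<Rightarrow> real" where
  "casimir_constant G K V = (THE c. \<forall>X\<in>V. casimir_operator G K X = c *\<^sub>R X)"

end

theory Submission
  imports Defs
begin

text \<open>
  Write \<open>C\<close> for the Casimir operator of \<open>k\<close> on \<open>m\<close>.  The theorem holds because the Ricci tensor of
  every connection \<open>\<nabla>\<^sup>s\<close> of the Killing metric is a combination of just two forms,
    \<open>Ric\<^sup>s(X, Y) = p B(X, Y) + q B(C X, Y)\<close>  with  \<open>p = (1 - (s - 1)\<^sup>2)/4\<close>, \<open>q = (1 + (s - 1)\<^sup>2)/2 > 0\<close>.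
  Since \<open>q\<close> is positive, each of the conditions "Einstein" (\<open>s = 1\<close>, the Levi-Civita connection) and
  "\<open>\<nabla>\<^sup>s\<close>-Einstein" says that \<open>C\<close> is a scalar on \<open>m\<close>.  As \<open>C\<close> is a scalar on each irreducible summand
  (\<open>casimir_constant\<close>), this means that the two Casimir constants agree.  The torsion of \<open>\<nabla>\<^sup>s\<close> is
  \<open>(s - 1)[X, Y]\<^sub>m\<close>, which is skew and, for \<open>s = 0\<close> and \<open>s = 2\<close>, is zero only if all \<open>[X, Y]\<^sub>m\<close> are.

  The Ricci formula (\<open>ricci_nabla_s\<close>) rests on two sums over an orthonormal basis of \<open>m\<close>.  Put
  \<open>P(X, Y) = \<Sum> B([X, e]\<^sub>k, [Y, e]\<^sub>k)\<close> and \<open>Q(X, Y) = \<Sum> B([X, e]\<^sub>m, [Y, e]\<^sub>m)\<close>.  The curvature formula and the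
  invariance of \<open>B\<close> give \<open>Ric\<^sup>s = (s/2 - s\<^sup>2/4) Q + P\<close>.  Exchanging the order of summation gives
  \<open>P(X, Y) = B(C X, Y)\<close> (\<open>sum_br_k_eq_casimir\<close>), and computing the trace that defines the Killing form in
  a basis adapted to \<open>k \<oplus> m\<close> gives \<open>B = Q + 2 P\<close> on \<open>m\<close> (\<open>sum_br_m_eq\<close>).

  All of this needs \<open>B\<close> to be an invariant inner product.  A compact matrix group preserves a positive
  definite form (\<open>invariant_positive_definite_form_exists\<close>, by a minimisation argument in place of
  invariant integration).  The elements of its Lie algebra are therefore skew for that form, so
  \<open>- tr (X Y)\<close> is an invariant inner product on the Lie algebra; with respect to it each \<open>ad X\<close> is skew
  as well, and \<open>B(X, X) = - tr (ad X)\<^sup>2\<close> is a sum of squares that vanishes only if \<open>X\<close> is central.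
  Semisimplicity excludes central \<open>X \<noteq> 0\<close>.
\<close>

section \<open>Inner products on subspaces\<close>

lemma linear_map_on_add:
  assumes "linear_map_on S f" "x \<in> S" "y \<in> S"
  shows "f (x + y) = f x + f y"
  using assms(1)[unfolded linear_map_on_def, rule_format, OF assms(2,3), of 1 1] by simp

lemma linear_map_on_scaleR:
  assumes "linear_map_on S f" "x \<in> S"
  shows "f (c *\<^sub>R x) = c *\<^sub>R f x"
  using assms(1)[unfolded linear_map_on_def, rule_format, OF assms(2,2), of c 0] by simp

lemma linear_map_on_diff:
  assumes "linear_map_on S f" "x \<in> S" "y \<in> S"
  shows "f (x - y) = f x - f y"
  using assms(1)[unfolded linear_map_on_def, rule_format, OF assms(2,3), of 1 "-1"] by simp

lemma linear_map_on_sum: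
  assumes "linear_map_on S f" "subspace S" "finite I" "\<And>i. i \<in> I \<Longrightarrow> x i \<in> S"
  shows "f (\<Sum>i\<in>I. c i *\<^sub>R x i) = (\<Sum>i\<in>I. c i *\<^sub>R f (x i))"
  using assms(3,4)
proof (induction I)
  case empty
  show ?case
    using linear_map_on_scaleR[OF assms(1) subspace_0[OF assms(2)], of 0] by simp
next
  case (insert j I)
  have "(\<Sum>i\<in>I. c i *\<^sub>R x i) \<in> S"
    using insert.prems by (intro subspace_sum subspace_scale assms(2)) auto
  moreover have "c j *\<^sub>R x j \<in> S"
    using insert.prems by (intro subspace_scale assms(2)) auto
  ultimately show ?case
    using insert by (simp add: linear_map_on_add[OF assms(1)] linear_map_on_scaleR[OF assms(1)])
qed

lemma linear_map_on_subset:
  "linear_map_on S f \<Longrightarrow> T \<subseteq> S \<Longrightarrow> linear_map_on T f"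
  by (auto simp: linear_map_on_def)

lemma linear_map_on_linear: "linear f \<Longrightarrow> linear_map_on S f"
  by (simp add: linear_map_on_def linear_add linear_scale)

lemma linear_map_on_compose:
  assumes "linear_map_on S f" "linear_map_on S g" "subspace S" "\<And>x. x \<in> S \<Longrightarrow> g x \<in> S"
  shows "linear_map_on S (\<lambda>x. f (g x))"
  using assms by (simp add: linear_map_on_def)

lemma basis_of_properties:
  fixes S :: "'a::euclidean_space set"
  assumes "subspace S"
  shows "independent (basis_of S)" "span (basis_of S) = S" "finite (basis_of S)"
proof -
  obtain E where "E \<subseteq> S" "independent E" "span E = S"
    by (metis assms basis_exists span_subspace)
  then have "\<exists>E. independent E \<and> span E = S" by blast
  then show "independent (basis_of S)" "span (basis_of S) = S"
    unfolding basis_of_def by (metis (mono_tags, lifting) someI_ex)+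
  then show "finite (basis_of S)"
    by (simp add: independent_imp_finite)
qed

lemma linear_map_on_representation:
  assumes "independent E" "span E = S"
  shows "linear_map_on S (\<lambda>x. representation E x e)"
  unfolding linear_map_on_def assms(2)[symmetric]
  using assms(1) by (simp add: representation_add representation_scale span_scale)

text \<open>Expand the first basis in the second and exchange the two sums.\<close>

lemma sum_representation_basis_independent:
  fixes S :: "'a::euclidean_space set"
  assumes S: "subspace S" and f: "linear_map_on S f" "\<And>x. x \<in> S \<Longrightarrow> f x \<in> S"
    and E: "independent E" "span E = S" and F: "independent F" "span F = S"
  shows "(\<Sum>e\<in>E. representation E (f e) e) = (\<Sum>h\<in>F. representation F (f h) h)"
proof -
  have fin: "finite E" "finite F"
    using E F by (simp_all add: independent_imp_finite)
  have ES: "e \<in> S" if "e \<in> E" for e using that E span_base by blast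
  have FS: "h \<in> S" if "h \<in> F" for h using that F span_base by blast
  have repE: "(\<Sum>e\<in>E. representation E x e *\<^sub>R e) = x" if "x \<in> S" for x
    using sum_representation_eq[OF E(1), of x E] that E(2) fin by simp
  have repF: "(\<Sum>h\<in>F. representation F x h *\<^sub>R h) = x" if "x \<in> S" for x
    using sum_representation_eq[OF F(1), of x F] that F(2) fin by simp
  note linE = linear_map_on_representation[OF E]
  note linF = linear_map_on_representation[OF F]
  have "(\<Sum>e\<in>E. representation E (f e) e)
      = (\<Sum>e\<in>E. representation E (f (\<Sum>h\<in>F. representation F e h *\<^sub>R h)) e)"
    by (intro sum.cong refl) (simp add: repF ES)
  also have "\<dots> = (\<Sum>e\<in>E. \<Sum>h\<in>F. representation F e h * representation E (f h) e)"
    by (intro sum.cong refl)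
      (simp add: linear_map_on_sum[OF f(1) S fin(2)] linear_map_on_sum[OF linE S fin(2)] FS f(2))
  also have "\<dots> = (\<Sum>h\<in>F. \<Sum>e\<in>E. representation E (f h) e * representation F e h)"
    by (subst sum.swap) (simp add: mult.commute)
  also have "\<dots> = (\<Sum>h\<in>F. representation F (\<Sum>e\<in>E. representation E (f h) e *\<^sub>R e) h)"
    by (intro sum.cong refl) (simp add: linear_map_on_sum[OF linF S fin(1)] ES)
  also have "\<dots> = (\<Sum>h\<in>F. representation F (f h) h)"
    by (intro sum.cong refl) (simp add: repE FS f(2))
  finally show ?thesis .
qed

definition is_orthonormal_basis :: "('a::real_vector \<Rightarrow> 'a \<Rightarrow> real) \<Rightarrow> 'a set \<Rightarrow> 'a set \<Rightarrow> bool" where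
  "is_orthonormal_basis b S E \<longleftrightarrow> independent E \<and> span E = S \<and>
     (\<forall>e\<in>E. \<forall>f\<in>E. b e f = (if e = f then 1 else 0))"

text \<open>The axioms speak about arguments in \<open>S\<close> only: the Killing form is given by a trace on the Lie
  algebra and has no meaning for other matrices.\<close>

locale inner_product_on =
  fixes S :: "'a::euclidean_space set" and b :: "'a \<Rightarrow> 'a \<Rightarrow> real"
  assumes subspace: "subspace S"
    and lin: "x \<in> S \<Longrightarrow> linear_map_on S (b x)"
    and sym: "x \<in> S \<Longrightarrow> y \<in> S \<Longrightarrow> b x y = b y x"
    and pos: "x \<in> S \<Longrightarrow> x \<noteq> 0 \<Longrightarrow> b x x > 0"
begin

lemma lin_left: "y \<in> S \<Longrightarrow> linear_map_on S (\<lambda>x. b x y)"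
  unfolding linear_map_on_def
proof (intro ballI allI)
  fix x z a c assume *: "y \<in> S" "x \<in> S" "z \<in> S"
  have "b (a *\<^sub>R x + c *\<^sub>R z) y = b y (a *\<^sub>R x + c *\<^sub>R z)"
    by (intro sym subspace_add subspace_scale subspace *)
  also have "\<dots> = a *\<^sub>R b y x + c *\<^sub>R b y z"
    using lin[OF *(1)] *(2,3) unfolding linear_map_on_def by blast
  finally show "b (a *\<^sub>R x + c *\<^sub>R z) y = a *\<^sub>R b x y + c *\<^sub>R b z y"
    using * sym by simp
qed

lemmas add_right = linear_map_on_add[OF lin]
lemmas diff_right = linear_map_on_diff[OF lin]
lemmas scale_right = linear_map_on_scaleR[OF lin]
lemmas sum_right = linear_map_on_sum[OF lin subspace]
lemmas add_left = linear_map_on_add[OF lin_left]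
lemmas diff_left = linear_map_on_diff[OF lin_left]
lemmas scale_left = linear_map_on_scaleR[OF lin_left]
lemmas sum_left = linear_map_on_sum[OF lin_left subspace]

lemma zero_right: "x \<in> S \<Longrightarrow> b x 0 = 0"
  using scale_right[of x x 0] by simp

lemma zero_left: "x \<in> S \<Longrightarrow> b 0 x = 0"
  using scale_left[of x x 0] by simp

lemma minus_right: "x \<in> S \<Longrightarrow> y \<in> S \<Longrightarrow> b x (- y) = - b x y"
  using scale_right[of x y "-1"] by simp

lemma minus_left: "x \<in> S \<Longrightarrow> y \<in> S \<Longrightarrow> b (- x) y = - b x y"
  using scale_left[of y x "-1"] by simp

lemma nonneg: "x \<in> S \<Longrightarrow> b x x \<ge> 0"
  using pos[of x] zero_right[of x] by fastforce

lemma zero_iff: "x \<in> S \<Longrightarrow> b x x = 0 \<longleftrightarrow> x = 0"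
  using pos[of x] zero_right[of x] by fastforce

lemma restrict: "subspace T \<Longrightarrow> T \<subseteq> S \<Longrightarrow> inner_product_on T b"
  by unfold_locales (simp | meson in_mono lin linear_map_on_subset sym pos)+

lemma eqI:
  assumes "x \<in> S" "y \<in> S" "\<And>z. z \<in> S \<Longrightarrow> b x z = b y z"
  shows "x = y"
proof -
  have "x - y \<in> S" using assms subspace subspace_diff by blast
  moreover from this have "b (x - y) (x - y) = 0"
    by (simp add: diff_left assms)
  ultimately show ?thesis using zero_iff by fastforce
qed

lemma orthonormal_imp_independent:
  assumes "finite E" "E \<subseteq> S" "\<And>e f. e \<in> E \<Longrightarrow> f \<in> E \<Longrightarrow> b e f = (if e = f then 1 else 0)"
  shows "independent E"
proof (rule independent_if_scalars_zero[OF assms(1)])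
  fix c x assume *: "(\<Sum>e\<in>E. c e *\<^sub>R e) = 0" and x: "x \<in> E"
  have "b x (\<Sum>e\<in>E. c e *\<^sub>R e) = (\<Sum>e\<in>E. c e * b x e)"
    using sum_right[of x E "\<lambda>e. e" c] assms x by auto
  also have "\<dots> = (\<Sum>e\<in>E. if e = x then c e else 0)"
    by (intro sum.cong refl) (use assms(3) x in auto)
  also have "\<dots> = c x" using x assms(1) by simp
  finally show "c x = 0" using * x assms(2) zero_right by auto
qed

text \<open>An orthonormal family of largest cardinality spans: the Gram--Schmidt step would enlarge
  any other one.\<close>

lemma orthonormal_basis_exists: "\<exists>E. is_orthonormal_basis b S E"
proof -
  define orth where "orth E \<longleftrightarrow> finite E \<and> E \<subseteq> S \<and>
    (\<forall>e\<in>E. \<forall>f\<in>E. b e f = (if e = f then 1 else 0))" for E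
  have indep: "independent E" if "orth E" for E
    using that orthonormal_imp_independent unfolding orth_def by blast
  have "\<exists>E. orth E \<and> (\<forall>F. orth F \<longrightarrow> card F \<le> card E)"
  proof (rule ex_has_greatest_nat)
    show "orth {}" by (simp add: orth_def)
    show "\<forall>F. orth F \<longrightarrow> card F < Suc DIM('a)"
      using indep independent_bound by (auto simp: less_Suc_eq_le)
  qed
  then obtain E where E: "orth E" and max: "\<And>F. orth F \<Longrightarrow> card F \<le> card E" by blast
  have fin: "finite E" and ES: "E \<subseteq> S" using E by (auto simp: orth_def)
  have "span E = S"
  proof (rule ccontr)
    assume "span E \<noteq> S"
    moreover have "span E \<subseteq> S" using ES subspace span_minimal by blast
    ultimately obtain x where x: "x \<in> S" "x \<notin> span E" by blast
    define p where "p = (\<Sum>e\<in>E. b x e *\<^sub>R e)"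
    have p: "p \<in> span E" unfolding p_def by (intro span_sum span_scale span_base)
    with \<open>span E \<subseteq> S\<close> have pS: "p \<in> S" by blast
    define y where "y = x - p"
    have y: "y \<in> S" "y \<noteq> 0"
      using x p pS subspace subspace_diff by (auto simp: y_def)
    have ey: "b e y = 0" if "e \<in> E" for e
    proof -
      have "b e p = (\<Sum>f\<in>E. b x f * b e f)"
        unfolding p_def using sum_right[of e E "\<lambda>e. e" "b x"] that fin ES by auto
      also have "\<dots> = (\<Sum>f\<in>E. if f = e then b x f else 0)"
        by (intro sum.cong refl) (use E that in \<open>auto simp: orth_def\<close>)
      also have "\<dots> = b e x" using that fin ES x sym by auto
      finally show ?thesis using that ES x pS by (auto simp: y_def diff_right)
    qed
    define z where "z = (1 / sqrt (b y y)) *\<^sub>R y"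
    have zS: "z \<in> S" using y subspace subspace_scale z_def by blast
    have ez: "b e z = 0" if "e \<in> E" for e
      using that ES y ey[OF that] by (auto simp: z_def scale_right)
    have zz: "b z z = 1"
      using y pos[OF y] subspace_scale[OF subspace]
      by (simp add: z_def scale_right scale_left real_sqrt_mult_self flip: power2_eq_square)
    have "z \<notin> E" using ez zz by fastforce
    moreover have "orth (insert z E)"
      using E zS ez zz sym \<open>z \<notin> E\<close> ES by (auto simp: orth_def subset_iff)
    ultimately show False using max[of "insert z E"] fin by simp
  qed
  then have "is_orthonormal_basis b S E"
    using E indep[OF E] unfolding is_orthonormal_basis_def orth_def by blast
  then show ?thesis ..
qed

lemma orthonormal_basis: "is_orthonormal_basis b S (orthonormal_basis b S)"
  using someI_ex[OF orthonormal_basis_exists]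
  unfolding orthonormal_basis_def is_orthonormal_basis_def .

context
  fixes E assumes E: "is_orthonormal_basis b S E"
begin

lemma onb_finite: "finite E"
  using E by (simp add: is_orthonormal_basis_def independent_imp_finite)

lemma onb_in: "e \<in> E \<Longrightarrow> e \<in> S"
  using E span_base by (auto simp: is_orthonormal_basis_def)

lemma onb_representation:
  assumes "x \<in> S" "e \<in> E"
  shows "representation E x e = b x e"
proof -
  have "x = (\<Sum>f\<in>E. representation E x f *\<^sub>R f)"
    using sum_representation_eq[of E x E] assms E onb_finite
    by (simp add: is_orthonormal_basis_def)
  then have "b x e = (\<Sum>f\<in>E. representation E x f * b f e)"
    using sum_left[of e E "\<lambda>e. e" "representation E x"] assms onb_finite onb_in by auto
  also have "\<dots> = (\<Sum>f\<in>E. if f = e then representation E x f else 0)"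
    by (intro sum.cong refl) (use E assms in \<open>auto simp: is_orthonormal_basis_def\<close>)
  finally show ?thesis using assms onb_finite by simp
qed

lemma onb_expansion:
  assumes "x \<in> S"
  shows "(\<Sum>e\<in>E. b x e *\<^sub>R e) = x"
proof -
  have "(\<Sum>e\<in>E. b x e *\<^sub>R e) = (\<Sum>e\<in>E. representation E x e *\<^sub>R e)"
    using assms by (intro sum.cong refl) (simp add: onb_representation)
  also have "\<dots> = x"
    using sum_representation_eq[of E x E] assms E onb_finite
    by (simp add: is_orthonormal_basis_def)
  finally show ?thesis .
qed

lemma onb_linear_map_on:
  assumes "linear_map_on S f" "x \<in> S"
  shows "f x = (\<Sum>e\<in>E. b x e *\<^sub>R f e)"
  using linear_map_on_sum[OF assms(1) subspace onb_finite, of "\<lambda>e. e" "b x"] onb_in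
    onb_expansion[OF assms(2)] by simp

lemma parseval:
  assumes "x \<in> S" "y \<in> S"
  shows "b x y = (\<Sum>e\<in>E. b x e * b y e)"
proof -
  have "b x y = (\<Sum>e\<in>E. b x e * b e y)"
    using onb_linear_map_on[OF lin_left[OF assms(2)] assms(1)] by simp
  also have "\<dots> = (\<Sum>e\<in>E. b x e * b y e)"
    using assms onb_in by (intro sum.cong refl) (simp add: sym)
  finally show ?thesis .
qed

lemma trace_on_eq_sum:
  assumes "linear_map_on S f" "\<And>x. x \<in> S \<Longrightarrow> f x \<in> S"
  shows "trace_on S f = (\<Sum>e\<in>E. b (f e) e)"
proof -
  have "trace_on S f = (\<Sum>e\<in>E. representation E (f e) e)"
    unfolding trace_on_def
    using sum_representation_basis_independent[OF subspace assms
        basis_of_properties(1,2)[OF subspace]] E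
    by (simp add: is_orthonormal_basis_def)
  then show ?thesis using onb_in assms(2) by (simp add: onb_representation)
qed

text \<open>A basis \<open>F\<close> together with its dual basis computes the same contraction of a
  bilinear map as an orthonormal basis: both are the contraction with the inverse of \<open>b\<close>.\<close>

lemma contraction_dual_basis:
  fixes \<phi> :: "'a \<Rightarrow> 'a \<Rightarrow> 'c::real_vector"
  assumes F: "independent F" "span F = S"
    and dual: "\<And>f. f \<in> F \<Longrightarrow> d f \<in> S" "\<And>f g. f \<in> F \<Longrightarrow> g \<in> F \<Longrightarrow> b g (d f) = (if g = f then 1 else 0)"
    and \<phi>: "\<And>x. x \<in> S \<Longrightarrow> linear_map_on S (\<phi> x)" "\<And>y. y \<in> S \<Longrightarrow> linear_map_on S (\<lambda>x. \<phi> x y)"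
  shows "(\<Sum>f\<in>F. \<phi> f (d f)) = (\<Sum>e\<in>E. \<phi> e e)"
proof -
  have fin: "finite F" using F by (simp add: independent_imp_finite)
  have FS: "f \<in> S" if "f \<in> F" for f using that F span_base by blast
  have coeff: "(\<Sum>f\<in>F. b (d f) x *\<^sub>R f) = x" if x: "x \<in> S" for x
  proof -
    have ex: "x = (\<Sum>f\<in>F. representation F x f *\<^sub>R f)"
      using sum_representation_eq[of F x F] x F fin by simp
    have "b (d f) x = representation F x f" if "f \<in> F" for f
    proof -
      have "b (d f) x = (\<Sum>g\<in>F. representation F x g * b (d f) g)"
        using sum_right[of "d f" F "\<lambda>f. f" "representation F x"] that dual fin FS ex by auto
      also have "\<dots> = (\<Sum>g\<in>F. if g = f then representation F x g else 0)"
        by (intro sum.cong refl) (use that dual sym FS in auto)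
      finally show ?thesis using that fin by simp
    qed
    then show ?thesis using ex by simp
  qed
  have "(\<Sum>f\<in>F. \<phi> f (d f)) = (\<Sum>f\<in>F. \<Sum>e\<in>E. b (d f) e *\<^sub>R \<phi> f e)"
    by (intro sum.cong refl onb_linear_map_on \<phi> dual FS)
  also have "\<dots> = (\<Sum>e\<in>E. \<Sum>f\<in>F. b (d f) e *\<^sub>R \<phi> f e)"
    by (rule sum.swap)
  also have "\<dots> = (\<Sum>e\<in>E. \<phi> (\<Sum>f\<in>F. b (d f) e *\<^sub>R f) e)"
    using linear_map_on_sum[OF \<phi>(2) subspace fin, symmetric] FS onb_in
    by (intro sum.cong refl) auto
  also have "\<dots> = (\<Sum>e\<in>E. \<phi> e e)"
    using onb_in by (intro sum.cong refl) (simp add: coeff)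
  finally show ?thesis .
qed

end

lemma trace_on_commute:
  assumes f: "linear_map_on S f" "\<And>x. x \<in> S \<Longrightarrow> f x \<in> S"
    and g: "linear_map_on S g" "\<And>x. x \<in> S \<Longrightarrow> g x \<in> S"
  shows "trace_on S (\<lambda>x. f (g x)) = trace_on S (\<lambda>x. g (f x))"
proof -
  obtain E where E: "is_orthonormal_basis b S E" using orthonormal_basis_exists by blast
  note inE = onb_in[OF E]
  have expand: "(\<Sum>e\<in>E. b (p (q e)) e) = (\<Sum>e\<in>E. \<Sum>h\<in>E. b (q e) h * b (p h) e)"
    if "linear_map_on S p" "\<And>x. x \<in> S \<Longrightarrow> p x \<in> S" "\<And>x. x \<in> S \<Longrightarrow> q x \<in> S" for p q
    using that inE onb_linear_map_on[OF E linear_map_on_compose[OF lin_left that(1) subspace]]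
    by (intro sum.cong refl) simp
  have "(\<Sum>e\<in>E. b (f (g e)) e) = (\<Sum>e\<in>E. \<Sum>h\<in>E. b (g e) h * b (f h) e)"
    using f g by (intro expand)
  also have "\<dots> = (\<Sum>h\<in>E. \<Sum>e\<in>E. b (f h) e * b (g e) h)"
    by (subst sum.swap) (simp add: mult.commute)
  also have "\<dots> = (\<Sum>h\<in>E. b (g (f h)) h)"
    using f g by (intro expand[symmetric])
  finally show ?thesis
    using f g by (simp add: trace_on_eq_sum[OF E] linear_map_on_compose subspace)
qed

lemma dual_vector:
  assumes F: "independent F" "span F = S" and f: "f \<in> F"
  shows "dual_vector b S F f \<in> S"
    and "\<And>g. g \<in> F \<Longrightarrow> b g (dual_vector b S F f) = (if g = f then 1 else 0)"
proof -
  obtain E where E: "is_orthonormal_basis b S E" using orthonormal_basis_exists by blast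
  have FS: "f \<in> S" if "f \<in> F" for f using that F span_base by blast
  let ?P = "\<lambda>d. d \<in> S \<and> (\<forall>g\<in>F. b g d = (if g = f then 1 else 0))"
  have "\<exists>!d. ?P d"
  proof (rule ex_ex1I)
    define d where "d = (\<Sum>e\<in>E. representation F e f *\<^sub>R e)"
    have "d \<in> S" unfolding d_def
      by (intro subspace_sum subspace_scale subspace onb_in[OF E])
    moreover have "b g d = (if g = f then 1 else 0)" if "g \<in> F" for g
    proof -
      note lin = linear_map_on_representation[OF F]
      have "b g d = (\<Sum>e\<in>E. representation F e f * b g e)"
        unfolding d_def using sum_right[of g E "\<lambda>e. e"] FS[OF that] onb_finite[OF E] onb_in[OF E]
        by auto
      also have "\<dots> = representation F g f"
        using onb_linear_map_on[OF E lin FS[OF that]] by (simp add: mult.commute)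
      finally show ?thesis using representation_basis[OF F(1) that] by auto
    qed
    ultimately show "\<exists>d. ?P d" by blast
  next
    fix d d' assume d: "?P d" "?P d'"
    have "b x d = b x d'" if "x \<in> S" for x
    proof -
      have "x \<in> span F" using that F by simp
      then have "x \<in> S \<and> b x d = b x d'"
      proof (induction rule: span_induct_alt)
        case base
        then show ?case using d subspace subspace_0 by (auto simp: zero_left)
      next
        case (step c x y)
        then show ?case using d FS[OF step(1)] subspace
          by (auto simp: add_left scale_left subspace_add subspace_scale)
      qed
      then show ?thesis by blast
    qed
    then show "d = d'" using eqI[of d d'] d sym by metis
  qed
  then have "?P (dual_vector b S F f)"
    unfolding dual_vector_def by (rule theI')
  then show "dual_vector b S F f \<in> S"
    and "\<And>g. g \<in> F \<Longrightarrow> b g (dual_vector b S F f) = (if g = f then 1 else 0)" by auto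
qed

definition complement :: "'a set \<Rightarrow> 'a set" where
  "complement T = {x \<in> S. \<forall>y\<in>T. b x y = 0}"

context
  fixes T assumes T: "subspace T" "T \<subseteq> S"
begin

lemma subspace_complement: "subspace (complement T)"
proof -
  have "y \<in> S" if "y \<in> T" for y using that T by blast
  then show ?thesis
    using subspace unfolding subspace_def complement_def
    by (auto simp: zero_left add_left[OF _ _ _] scale_left)
qed

text \<open>Subtract the orthogonal projection to \<open>T\<close>.\<close>

lemma complement_decomposition:
  assumes "x \<in> S"
  shows "\<exists>y\<in>T. x - y \<in> complement T"
proof -
  interpret T: inner_product_on T b using T by (rule restrict)
  obtain E where E: "is_orthonormal_basis b T E" using T.orthonormal_basis_exists by blast
  define y where "y = (\<Sum>e\<in>E. b x e *\<^sub>R e)"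
  have inE: "e \<in> S" if "e \<in> E" for e using T.onb_in[OF E that] T by blast
  have yT: "y \<in> T" unfolding y_def
    by (intro subspace_sum subspace_scale T.subspace T.onb_in[OF E])
  have "b (x - y) z = 0" if z: "z \<in> T" for z
  proof -
    have zS: "z \<in> S" and yS: "y \<in> S" using z yT T by auto
    have "b y z = (\<Sum>e\<in>E. b x e * b e z)"
      unfolding y_def using sum_left[OF zS T.onb_finite[OF E], of "\<lambda>e. e" "b x"] inE by simp
    also have "\<dots> = (\<Sum>e\<in>E. b z e * b x e)"
      by (intro sum.cong refl) (use zS inE sym in auto)
    also have "\<dots> = b x z"
      using T.onb_linear_map_on[OF E linear_map_on_subset[OF lin[OF assms] T(2)] z] by simp
    finally show ?thesis using zS yS assms by (simp add: diff_left)
  qed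
  moreover have "x - y \<in> S" using assms yT T subspace subspace_diff by blast
  ultimately show ?thesis using yT by (auto simp: complement_def)
qed

lemma complement_unique:
  assumes "y \<in> T" "y' \<in> T" "x - y \<in> complement T" "x - y' \<in> complement T"
  shows "y = y'"
proof -
  have "(x - y') - (x - y) \<in> complement T"
    using assms subspace_complement subspace_diff by blast
  then have 1: "y - y' \<in> complement T" by simp
  have 2: "y - y' \<in> T" using assms T subspace_diff by blast
  then have "b (y - y') (y - y') = 0" using 1 by (auto simp: complement_def)
  then show ?thesis using 2 T zero_iff[of "y - y'"] by auto
qed

lemma component_eq:
  assumes "y \<in> T" "z \<in> complement T"
  shows "component T (complement T) (y + z) = y"
  unfolding component_def
  by (rule the_equality) (use assms complement_unique in auto)

lemma component_complement_eq:
  assumes "y \<in> T" "z \<in> complement T"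
  shows "component (complement T) T (y + z) = z"
  unfolding component_def
proof (rule the_equality)
  show "z \<in> complement T \<and> y + z - z \<in> T" using assms by simp
  fix w assume w: "w \<in> complement T \<and> y + z - w \<in> T"
  have "y + z - w = y"
    by (rule complement_unique[of _ _ "y + z"]) (use w assms in auto)
  then show "w = z" by simp
qed

lemma orthonormal_basis_Un_complement:
  assumes E: "is_orthonormal_basis b T E" and F: "is_orthonormal_basis b (complement T) F"
  shows "is_orthonormal_basis b S (E \<union> F)" and "E \<inter> F = {}"
proof -
  interpret T: inner_product_on T b using T by (rule restrict)
  interpret C: inner_product_on "complement T" b
    by (rule restrict) (use subspace_complement in \<open>auto simp: complement_def\<close>)
  have ET: "e \<in> T" if "e \<in> E" for e using T.onb_in[OF E that] .
  have FC: "f \<in> complement T" if "f \<in> F" for f using C.onb_in[OF F that] .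
  have sub: "E \<union> F \<subseteq> S" using ET FC T by (auto simp: complement_def)
  have ef: "b e f = 0" "b f e = 0" if "e \<in> E" "f \<in> F" for e f
  proof -
    show "b f e = 0" using ET FC that by (auto simp: complement_def)
    then show "b e f = 0" using sym[of e f] sub that by auto
  qed
  show disj: "E \<inter> F = {}"
  proof (rule ccontr)
    assume "E \<inter> F \<noteq> {}"
    then obtain e where "e \<in> E" "e \<in> F" by blast
    then show False using ef[of e e] E by (auto simp: is_orthonormal_basis_def)
  qed
  have on: "b e f = (if e = f then 1 else 0)" if "e \<in> E \<union> F" "f \<in> E \<union> F" for e f
    using that ef disj E F by (auto simp: is_orthonormal_basis_def)
  have "x \<in> span (E \<union> F)" if xS: "x \<in> S" for x
  proof -
    obtain y where y: "y \<in> T" "x - y \<in> complement T"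
      using complement_decomposition[OF xS] by blast
    then have "y \<in> span E" "x - y \<in> span F" using E F by (auto simp: is_orthonormal_basis_def)
    then have "y + (x - y) \<in> span (E \<union> F)"
      by (meson in_mono span_add span_mono sup_ge1 sup_ge2)
    then show ?thesis by simp
  qed
  moreover have "span (E \<union> F) \<subseteq> S" using sub subspace span_minimal by blast
  ultimately have "span (E \<union> F) = S" by blast
  moreover have "independent (E \<union> F)"
    using orthonormal_imp_independent[OF _ sub on] T.onb_finite[OF E] C.onb_finite[OF F] by auto
  ultimately show "is_orthonormal_basis b S (E \<union> F)"
    using on by (auto simp: is_orthonormal_basis_def)
qed

end

end

section \<open>Matrix groups preserving a positive definite form\<close>

lemma matrix_add_rdistrib: "(A + B) ** C = A ** C + B ** (C :: 'a::semiring_1 ^ 'n ^ 'm)"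
  by (simp add: matrix_matrix_mult_def vec_eq_iff sum.distrib distrib_right)

lemma bounded_bilinear_matrix_mult:
  "bounded_bilinear (\<lambda>A B. A ** B :: real ^ 'n::finite ^ 'n)"
  unfolding bilinear_conv_bounded_bilinear[symmetric] bilinear_def
  by (auto intro!: linearI simp: matrix_add_ldistrib matrix_add_rdistrib matrix_scalar_ac
      scalar_matrix_assoc)

interpretation matrix_mult: bounded_bilinear "\<lambda>A B. A ** B :: real ^ 'n::finite ^ 'n"
  by (rule bounded_bilinear_matrix_mult)

lemma bounded_linear_transpose:
  "bounded_linear (transpose :: real ^ 'n::finite ^ 'n \<Rightarrow> real ^ 'n ^ 'n)"
  unfolding linear_conv_bounded_linear[symmetric]
  by (rule linearI) (auto simp: transpose_def vec_eq_iff)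

lemma bounded_bilinear_bracket: "bounded_bilinear (bracket :: 'n::finite mat \<Rightarrow> _)"
  unfolding bilinear_conv_bounded_bilinear[symmetric] bilinear_def bracket_def
  by (auto intro!: linearI simp: matrix_mult.add_left matrix_mult.add_right
      matrix_mult.scaleR_left matrix_mult.scaleR_right algebra_simps)

interpretation bracket: bounded_bilinear "bracket :: 'n::finite mat \<Rightarrow> _"
  by (rule bounded_bilinear_bracket)

lemma bracket_self: "bracket X X = 0"
  by (simp add: bracket_def)

lemma bracket_skew: "bracket X Y = - bracket Y X"
  by (simp add: bracket_def)

lemma jacobi: "bracket (bracket X Y) Z = bracket X (bracket Y Z) - bracket Y (bracket X Z)"
  by (simp add: bracket_def matrix_mult.diff_left matrix_mult.diff_right matrix_mul_assoc)

lemma linear_map_on_bracket: "linear_map_on S (bracket X)"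
  by (rule linear_map_on_linear) (rule bounded_linear.linear[OF bracket.bounded_linear_right])

lemma matrix_inv_inverse:
  assumes "invertible A"
  shows "A ** matrix_inv A = mat 1" "matrix_inv A ** A = mat 1"
  using someI_ex[OF assms[unfolded invertible_def]] by (auto simp: matrix_inv_def)

lemma matrix_inv_cancel:
  fixes A :: "'n::finite mat"
  assumes "invertible A"
  shows "X ** A ** matrix_inv A = X" "X ** matrix_inv A ** A = X"
  using matrix_inv_inverse[OF assms] by (simp_all flip: matrix_mul_assoc)

lemma matrix_inv_unique_left:
  fixes A :: "'n::finite mat"
  assumes "invertible A" "B ** A = mat 1"
  shows "matrix_inv A = B"
  using matrix_inv_cancel(1)[OF assms(1), of B] assms(2) by simp

lemma linear_Ad: "linear (Ad A)"
  by (rule linearI)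
    (simp_all add: Ad_def matrix_mult.add_left matrix_mult.add_right
      matrix_mult.scaleR_left matrix_mult.scaleR_right)

lemma Ad_bracket:
  assumes "invertible A"
  shows "Ad A (bracket X Y) = bracket (Ad A X) (Ad A Y)"
  by (simp add: Ad_def bracket_def matrix_mult.diff_left matrix_mult.diff_right matrix_mul_assoc
      matrix_inv_cancel[OF assms])

lemma Ad_inverse:
  assumes "invertible A" "invertible (matrix_inv A)"
  shows "Ad A (Ad (matrix_inv A) X) = X" "Ad (matrix_inv A) (Ad A X) = X"
proof -
  have inv: "matrix_inv (matrix_inv A) = A"
    by (rule matrix_inv_unique_left[OF assms(2) matrix_inv_inverse(1)[OF assms(1)]])
  show "Ad A (Ad (matrix_inv A) X) = X" "Ad (matrix_inv A) (Ad A X) = X"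
    by (simp_all add: Ad_def inv matrix_mul_assoc matrix_inv_cancel[OF assms(1)]
        matrix_inv_inverse[OF assms(1)])
qed

lemma matrix_group_invertible: "matrix_group G \<Longrightarrow> A \<in> G \<Longrightarrow> invertible A"
  by (simp add: matrix_group_def)

lemma matrix_group_inv: "matrix_group G \<Longrightarrow> A \<in> G \<Longrightarrow> matrix_inv A \<in> G"
  by (simp add: matrix_group_def)

text \<open>On the compact convex hull of the forms \<open>A\<^sup>T A\<close> with \<open>A \<in> G\<close>, all of which are positive
  definite, consider the largest Frobenius norm in the orbit of a form under \<open>G\<close>.  This function is
  continuous and invariant, and by the parallelogram identity it has only one minimum point.  That
  point is fixed by \<open>G\<close>.\<close>

lemma invariant_positive_definite_form_exists:
  fixes G :: "'n::finite mat set"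
  assumes G: "matrix_group G" and "compact G"
  shows "\<exists>S. transpose S = S \<and> (\<forall>x. x \<noteq> 0 \<longrightarrow> x \<bullet> (S *v x) > 0) \<and>
    (\<forall>A\<in>G. transpose A ** S ** A = S)"
proof -
  define act :: "'n mat \<Rightarrow> 'n mat \<Rightarrow> 'n mat" where "act A S = transpose A ** S ** A" for A S
  define H where "H = convex hull ((\<lambda>A. act A (mat 1)) ` G)"
  define \<phi> where "\<phi> S = (SUP A\<in>G. norm (act A S))" for S
  have one: "mat 1 \<in> G" and ne: "G \<noteq> {}" using G by (auto simp: matrix_group_def)
  have cont: "continuous_on G (\<lambda>A. act A S)" for S
    unfolding act_def
    by (intro bounded_bilinear.continuous_on[OF bounded_bilinear_matrix_mult]
        bounded_linear.continuous_on[OF bounded_linear_transpose] continuous_intros)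
  have lin: "linear (act A)" for A
    unfolding act_def
    by (rule linearI) (simp_all add: matrix_mult.add_left matrix_mult.add_right
        matrix_mult.scaleR_left matrix_mult.scaleR_right)
  have act_act: "act A (act C S) = act (C ** A) S" for A C S
    by (simp add: act_def matrix_transpose_mul matrix_mul_assoc)
  have inj: "S = T" if "act A S = act A T" "A \<in> G" for A S T
  proof -
    have inv: "invertible A" using G that matrix_group_invertible by blast
    have "act (matrix_inv A) (act A R) = R" for R
      by (simp add: act_act matrix_inv_inverse[OF inv]) (simp add: act_def)
    then show ?thesis using that by metis
  qed
  have att: "\<exists>A\<in>G. \<phi> S = norm (act A S) \<and> (\<forall>C\<in>G. norm (act C S) \<le> norm (act A S))" for S
  proof -
    obtain A where A: "A \<in> G" "\<forall>C\<in>G. norm (act C S) \<le> norm (act A S)"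
      using continuous_attains_sup[OF \<open>compact G\<close> ne continuous_on_norm[OF cont]] by blast
    then have "\<phi> S = norm (act A S)"
      unfolding \<phi>_def by (intro cSup_eq_maximum) auto
    then show ?thesis using A by blast
  qed
  have upper: "norm (act A S) \<le> \<phi> S" if "A \<in> G" for A S
    using att[of S] that by auto
  have "convex_on UNIV \<phi>"
  proof (rule convex_onI)
    fix t :: real and x y assume t: "0 < t" "t < 1"
    obtain A where A: "A \<in> G" "\<phi> ((1 - t) *\<^sub>R x + t *\<^sub>R y) = norm (act A ((1 - t) *\<^sub>R x + t *\<^sub>R y))"
      using att by blast
    have "norm (act A ((1 - t) *\<^sub>R x + t *\<^sub>R y))
        \<le> norm ((1 - t) *\<^sub>R act A x) + norm (t *\<^sub>R act A y)"
      unfolding linear_add[OF lin] linear_scale[OF lin] by (rule norm_triangle_ineq)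
    also have "\<dots> \<le> (1 - t) * \<phi> x + t * \<phi> y"
      using t upper[OF A(1)] by (simp add: add_mono)
    finally show "\<phi> ((1 - t) *\<^sub>R x + t *\<^sub>R y) \<le> (1 - t) * \<phi> x + t * \<phi> y"
      using A by simp
  qed simp
  then have "continuous_on H \<phi>"
    using convex_on_continuous[OF open_UNIV] continuous_on_subset by blast
  moreover have "compact H"
    unfolding H_def by (intro compact_convex_hull compact_continuous_image cont \<open>compact G\<close>)
  moreover have "H \<noteq> {}" using ne by (simp add: H_def)
  ultimately obtain S where S: "S \<in> H" and min: "\<And>T. T \<in> H \<Longrightarrow> \<phi> S \<le> \<phi> T"
    using continuous_attains_inf[of H \<phi>] by blast
  have unique: "T = S" if T: "T \<in> H" "\<phi> T \<le> \<phi> S" for T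
  proof (rule ccontr)
    assume "T \<noteq> S"
    define M where "M = (1 / 2) *\<^sub>R S + (1 / 2) *\<^sub>R T"
    have "M \<in> H" unfolding M_def H_def
      by (rule convexD) (use S T in \<open>auto simp: H_def\<close>)
    obtain A where A: "A \<in> G" "\<phi> M = norm (act A M)" using att by blast
    have "act A M = (1 / 2) *\<^sub>R (act A S + act A T)"
      by (simp add: M_def linear_add[OF lin] linear_scale[OF lin] scaleR_add_right)
    then have "4 * (norm (act A M))\<^sup>2 = (norm (act A S + act A T))\<^sup>2"
      by (simp add: power_divide)
    also have "\<dots> = 2 * (norm (act A S))\<^sup>2 + 2 * (norm (act A T))\<^sup>2 - (norm (act A S - act A T))\<^sup>2"
      by (simp add: power2_norm_eq_inner inner_add inner_diff inner_commute)
    also have "\<dots> < 2 * (norm (act A S))\<^sup>2 + 2 * (norm (act A T))\<^sup>2"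
      using inj[OF _ A(1), of S T] \<open>T \<noteq> S\<close> by auto
    also have "\<dots> \<le> 2 * (\<phi> S)\<^sup>2 + 2 * (\<phi> S)\<^sup>2"
      using upper[OF A(1), of S] upper[OF A(1), of T] T(2)
      by (intro add_mono mult_left_mono power_mono) auto
    finally have "(\<phi> M)\<^sup>2 < (\<phi> S)\<^sup>2" using A by simp
    moreover have "0 \<le> \<phi> S" using upper[OF one, of S] norm_ge_zero order_trans by blast
    ultimately have "\<phi> M < \<phi> S" using power_less_imp_less_base by blast
    then show False using min[OF \<open>M \<in> H\<close>] by simp
  qed
  have "act A S = S" if A: "A \<in> G" for A
  proof (rule unique)
    have "act A ` H = convex hull (act A ` (\<lambda>C. act C (mat 1)) ` G)"
      unfolding H_def by (simp add: convex_hull_linear_image lin)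
    also have "\<dots> \<subseteq> H"
      unfolding H_def
      by (rule hull_mono) (use G A in \<open>auto simp: act_act matrix_group_def\<close>)
    finally show "act A S \<in> H" using S by blast
    obtain C where "C \<in> G" "\<phi> (act A S) = norm (act C (act A S))" using att by blast
    then show "\<phi> (act A S) \<le> \<phi> S"
      using upper[of "A ** C" S] G A by (auto simp: act_act matrix_group_def)
  qed
  moreover have "transpose S = S \<and> (\<forall>x. x \<noteq> 0 \<longrightarrow> x \<bullet> (S *v x) > 0)"
  proof -
    let ?P = "{S :: 'n mat. transpose S = S \<and> (\<forall>x. x \<noteq> 0 \<longrightarrow> x \<bullet> (S *v x) > 0)}"
    have "convex ?P"
    proof (rule convexI)
      fix X Y and u v :: real
      assume "X \<in> ?P" "Y \<in> ?P" "0 \<le> u" "0 \<le> v" "u + v = 1"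
      then show "u *\<^sub>R X + v *\<^sub>R Y \<in> ?P"
      proof (cases "u = 0")
        case True
        then show ?thesis using \<open>Y \<in> ?P\<close> \<open>u + v = 1\<close> by simp
      next
        case False
        have "x \<bullet> ((u *\<^sub>R X + v *\<^sub>R Y) *v x) > 0" if "x \<noteq> 0" for x
        proof -
          have "x \<bullet> ((u *\<^sub>R X + v *\<^sub>R Y) *v x) = u * (x \<bullet> (X *v x)) + v * (x \<bullet> (Y *v x))"
            by (simp add: matrix_vector_mult_add_rdistrib inner_add_right
                scaleR_matrix_vector_assoc[symmetric])
          also have "\<dots> > 0"
            using \<open>X \<in> ?P\<close> \<open>Y \<in> ?P\<close> \<open>0 \<le> u\<close> \<open>0 \<le> v\<close> False that
            by (intro add_pos_nonneg mult_nonneg_nonneg mult_pos_pos)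
              (auto intro: order.strict_implies_order)
          finally show ?thesis .
        qed
        then show ?thesis using \<open>X \<in> ?P\<close> \<open>Y \<in> ?P\<close>
          by (simp add: linear_add[OF bounded_linear.linear[OF bounded_linear_transpose]]
              transpose_scalar)
      qed
    qed
    moreover have "act A (mat 1) \<in> ?P" if A: "A \<in> G" for A
    proof -
      have "x \<bullet> (act A (mat 1) *v x) = (A *v x) \<bullet> (A *v x)" for x
        using dot_lmul_matrix[of "A *v x" A x]
        by (simp add: act_def inner_commute flip: matrix_vector_mul_assoc)
      moreover have "A *v x \<noteq> 0" if "x \<noteq> 0" for x
        using injD[OF inj_matrix_vector_mult[OF matrix_group_invertible[OF G A]], of x 0] that
        by auto
      ultimately show ?thesis by (simp add: act_def matrix_transpose_mul)
    qed
    ultimately have "H \<subseteq> ?P" unfolding H_def by (intro hull_minimal) auto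
    then show ?thesis using S by blast
  qed
  ultimately show ?thesis unfolding act_def by blast
qed

section \<open>The Lie algebra\<close>

text \<open>Every linear functional that vanishes on \<open>V\<close> vanishes along \<open>f\<close>, hence on the derivative.\<close>

lemma has_vector_derivative_in_subspace:
  fixes f :: "real \<Rightarrow> 'a::euclidean_space"
  assumes V: "subspace V" and f: "\<And>t. f t \<in> V" and D: "(f has_vector_derivative D) (at x)"
  shows "D \<in> V"
proof -
  obtain y z where yz: "y \<in> span V" "\<And>w. w \<in> span V \<Longrightarrow> orthogonal z w" "D = y + z"
    using orthogonal_subspace_decomp_exists by blast
  have "((\<lambda>t. z \<bullet> f t) has_vector_derivative z \<bullet> D) (at x)"
    by (rule bounded_linear.has_vector_derivative[OF bounded_linear_inner_right D])
  moreover have "(\<lambda>t. z \<bullet> f t) = (\<lambda>t. 0)"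
    using yz(2) f by (auto simp: orthogonal_def span_base)
  ultimately have "z \<bullet> D = 0"
    by (metis has_vector_derivative_const vector_derivative_unique_at)
  then have "z = 0" using yz by (simp add: inner_add_right orthogonal_def)
  then show ?thesis using yz V by (simp add: span_eq_iff[THEN iffD2])
qed

text \<open>The preserved form \<open>S\<close> is a parameter, so that a group and its subgroups can share it.\<close>

locale orthogonal_matrix_group =
  fixes G :: "'n::finite mat set" and S :: "'n mat"
  assumes group: "matrix_group G"
    and form_symmetric: "transpose S = S"
    and form_positive: "x \<noteq> 0 \<Longrightarrow> x \<bullet> (S *v x) > 0"
    and form_invariant: "A \<in> G \<Longrightarrow> transpose A ** S ** A = S"
begin

lemmas invertible = matrix_group_invertible[OF group]

lemma Ad_inv:
  assumes "A \<in> G"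
  shows "Ad A (Ad (matrix_inv A) X) = X" "Ad (matrix_inv A) (Ad A X) = X"
  using Ad_inverse[of A] invertible matrix_group_inv[OF group] assms by auto

lemma lie_algebraE:
  assumes "X \<in> lie_algebra G"
  obtains \<gamma> :: "real \<Rightarrow> 'n mat" where "\<And>t. \<gamma> t \<in> G" "\<And>t. \<gamma> differentiable (at t)"
    "\<gamma> 0 = mat 1" "(\<gamma> has_vector_derivative X) (at 0)"
  using assms by (auto simp: lie_algebra_def)

lemma subspace_lie_algebra: "subspace (lie_algebra G)"
proof (rule subspaceI)
  have "mat 1 \<in> G" using group by (simp add: matrix_group_def)
  then show "0 \<in> lie_algebra G"
    unfolding lie_algebra_def by (auto intro!: exI[of _ "\<lambda>_. mat 1"])
next
  fix X Y assume X: "X \<in> lie_algebra G" and Y: "Y \<in> lie_algebra G"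
  obtain \<alpha> :: "real \<Rightarrow> 'n mat" where \<alpha>: "\<And>t. \<alpha> t \<in> G" "\<And>t. \<alpha> differentiable (at t)"
    "\<alpha> 0 = mat 1" "(\<alpha> has_vector_derivative X) (at 0)" by (rule lie_algebraE[OF X]) (rule that)
  obtain \<beta> :: "real \<Rightarrow> 'n mat" where \<beta>: "\<And>t. \<beta> t \<in> G" "\<And>t. \<beta> differentiable (at t)"
    "\<beta> 0 = mat 1" "(\<beta> has_vector_derivative Y) (at 0)" by (rule lie_algebraE[OF Y]) (rule that)
  have "(\<lambda>t. \<alpha> t ** \<beta> t) differentiable (at t)" for t
    using bounded_bilinear.FDERIV[OF bounded_bilinear_matrix_mult] \<alpha>(2)[of t] \<beta>(2)[of t]
    unfolding differentiable_def by blast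
  moreover have "((\<lambda>t. \<alpha> t ** \<beta> t) has_vector_derivative X + Y) (at 0)"
    using bounded_bilinear.has_vector_derivative[OF bounded_bilinear_matrix_mult \<alpha>(4) \<beta>(4)]
      \<alpha>(3) \<beta>(3) by (simp add: add.commute)
  ultimately show "X + Y \<in> lie_algebra G"
    using \<alpha> \<beta> group unfolding lie_algebra_def matrix_group_def
    by (auto intro!: exI[of _ "\<lambda>t. \<alpha> t ** \<beta> t"])
next
  fix c X assume X: "X \<in> lie_algebra G"
  obtain \<alpha> :: "real \<Rightarrow> 'n mat" where \<alpha>: "\<And>t. \<alpha> t \<in> G" "\<And>t. \<alpha> differentiable (at t)"
    "\<alpha> 0 = mat 1" "(\<alpha> has_vector_derivative X) (at 0)" by (rule lie_algebraE[OF X]) (rule that)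
  have scale: "((\<lambda>t. c * t) has_vector_derivative c) (at t)" for t
    by (auto intro!: derivative_eq_intros)
  have "(\<alpha> \<circ> (\<lambda>t. c * t)) differentiable (at t)" for t
    by (rule differentiable_chain_at) (use \<alpha>(2) in \<open>auto intro!: derivative_intros\<close>)
  moreover have "((\<alpha> \<circ> (\<lambda>t. c * t)) has_vector_derivative c *\<^sub>R X) (at 0)"
    by (rule vector_diff_chain_at[OF scale]) (use \<alpha>(4) in simp)
  ultimately show "c *\<^sub>R X \<in> lie_algebra G"
    using \<alpha> unfolding lie_algebra_def by (auto intro!: exI[of _ "\<alpha> \<circ> (\<lambda>t. c * t)"])
qed

lemma Ad_lie_algebra:
  assumes "A \<in> G" "X \<in> lie_algebra G"
  shows "Ad A X \<in> lie_algebra G"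
proof -
  obtain \<alpha> :: "real \<Rightarrow> 'n mat" where \<alpha>: "\<And>t. \<alpha> t \<in> G" "\<And>t. \<alpha> differentiable (at t)"
    "\<alpha> 0 = mat 1" "(\<alpha> has_vector_derivative X) (at 0)" by (rule lie_algebraE[OF assms(2)]) (rule that)
  have bl: "bounded_linear (Ad A)" using linear_Ad by (simp add: linear_conv_bounded_linear)
  have "(\<lambda>t. Ad A (\<alpha> t)) differentiable (at t)" for t
    using bounded_linear.has_derivative[OF bl] \<alpha>(2)[of t] unfolding differentiable_def by blast
  moreover have "((\<lambda>t. Ad A (\<alpha> t)) has_vector_derivative Ad A X) (at 0)"
    by (rule bounded_linear.has_vector_derivative[OF bl \<alpha>(4)])
  moreover have "Ad A (\<alpha> t) \<in> G" for t
    using \<alpha>(1) assms(1) group by (simp add: Ad_def matrix_group_def)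
  moreover have "Ad A (\<alpha> 0) = mat 1"
    using \<alpha>(3) matrix_inv_inverse[OF invertible[OF assms(1)]] by (simp add: Ad_def)
  ultimately show ?thesis
    unfolding lie_algebra_def by (auto intro!: exI[of _ "\<lambda>t. Ad A (\<alpha> t)"])
qed

text \<open>Differentiate \<open>\<gamma>\<^sup>T S \<gamma> = S\<close>.\<close>

lemma lie_algebra_skew:
  assumes "X \<in> lie_algebra G"
  shows "transpose X ** S + S ** X = 0"
proof -
  obtain \<gamma> :: "real \<Rightarrow> 'n mat" where \<gamma>: "\<And>t. \<gamma> t \<in> G"
    "\<gamma> 0 = mat 1" "(\<gamma> has_vector_derivative X) (at 0)" by (rule lie_algebraE[OF assms]) (rule that)
  have "((\<lambda>t. transpose (\<gamma> t) ** (S ** \<gamma> t)) has_vector_derivative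
      transpose (\<gamma> 0) ** (S ** X) + transpose X ** (S ** \<gamma> 0)) (at 0)"
    by (intro bounded_bilinear.has_vector_derivative[OF bounded_bilinear_matrix_mult]
        bounded_linear.has_vector_derivative[OF bounded_linear_transpose]
        bounded_linear.has_vector_derivative[OF matrix_mult.bounded_linear_right] \<gamma>(3))
  moreover have "(\<lambda>t. transpose (\<gamma> t) ** (S ** \<gamma> t)) = (\<lambda>t. S)"
    using form_invariant[OF \<gamma>(1)] by (simp add: matrix_mul_assoc)
  ultimately have "transpose (\<gamma> 0) ** (S ** X) + transpose X ** (S ** \<gamma> 0) = 0"
    by (metis has_vector_derivative_const vector_derivative_unique_at)
  then show ?thesis using \<gamma>(2) by (simp add: add.commute)
qed

text \<open>Inversion is differentiable because \<open>A\<^sup>-\<^sup>1 = S\<^sup>-\<^sup>1 A\<^sup>T S\<close> for \<open>A\<close> in the group; the bracket is then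
  the derivative of the adjoint action along a curve, which stays in the Lie algebra.\<close>

lemma bracket_lie_algebra:
  assumes X: "X \<in> lie_algebra G" and Y: "Y \<in> lie_algebra G"
  shows "bracket X Y \<in> lie_algebra G"
proof -
  obtain J where J: "J ** S = mat 1"
  proof -
    have "\<forall>x. S *v x = 0 \<longrightarrow> x = 0" using form_positive by fastforce
    then show ?thesis using that matrix_left_invertible_ker[of S] by blast
  qed
  have inv: "matrix_inv A = J ** (transpose A ** S)" if "A \<in> G" for A
    using form_invariant[OF that] J
    by (intro matrix_inv_unique_left invertible[OF that]) (simp flip: matrix_mul_assoc)
  obtain \<gamma> :: "real \<Rightarrow> 'n mat" where \<gamma>: "\<And>t. \<gamma> t \<in> G"
    "\<gamma> 0 = mat 1" "(\<gamma> has_vector_derivative X) (at 0)" by (rule lie_algebraE[OF X]) (rule that)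
  have "((\<lambda>t. (\<gamma> t ** Y) ** (J ** (transpose (\<gamma> t) ** S))) has_vector_derivative
      (\<gamma> 0 ** Y) ** (J ** (transpose X ** S)) + (X ** Y) ** (J ** (transpose (\<gamma> 0) ** S))) (at 0)"
    by (intro bounded_bilinear.has_vector_derivative[OF bounded_bilinear_matrix_mult]
        bounded_linear.has_vector_derivative[OF matrix_mult.bounded_linear_right]
        bounded_linear.has_vector_derivative[OF matrix_mult.bounded_linear_left]
        bounded_linear.has_vector_derivative[OF bounded_linear_transpose] \<gamma>(3))
  moreover have "transpose X ** S = - (S ** X)"
    using lie_algebra_skew[OF X] by (simp add: eq_neg_iff_add_eq_0)
  moreover have "J ** (S ** X) = X" using J by (simp add: matrix_mul_assoc)
  moreover have "(\<gamma> t ** Y) ** (J ** (transpose (\<gamma> t) ** S)) = Ad (\<gamma> t) Y" for t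
    using inv[OF \<gamma>(1)] by (simp add: Ad_def)
  ultimately have "((\<lambda>t. Ad (\<gamma> t) Y) has_vector_derivative bracket X Y) (at 0)"
    using J \<gamma>(2) by (simp add: bracket_def matrix_mult.minus_right)
  then show ?thesis
    by (rule has_vector_derivative_in_subspace[OF subspace_lie_algebra Ad_lie_algebra[OF \<gamma>(1) Y]])
qed

lemma is_orthonormal_basis_Ad:
  assumes A: "A \<in> G" and E: "is_orthonormal_basis b (lie_algebra G) E"
    and b: "\<And>X Y. X \<in> lie_algebra G \<Longrightarrow> Y \<in> lie_algebra G \<Longrightarrow> b (Ad A X) (Ad A Y) = b X Y"
  shows "is_orthonormal_basis b (lie_algebra G) (Ad A ` E)"
proof -
  have inj: "inj (Ad A)" by (rule inj_on_inverseI) (rule Ad_inv(2)[OF A])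
  have AG: "Ad A ` lie_algebra G = lie_algebra G"
  proof
    show "Ad A ` lie_algebra G \<subseteq> lie_algebra G" using Ad_lie_algebra[OF A] by blast
    show "lie_algebra G \<subseteq> Ad A ` lie_algebra G"
    proof
      fix X assume "X \<in> lie_algebra G"
      then have "Ad (matrix_inv A) X \<in> lie_algebra G"
        by (rule Ad_lie_algebra[OF matrix_group_inv[OF group A]])
      then show "X \<in> Ad A ` lie_algebra G"
        using Ad_inv(1)[OF A, of X] by (metis imageI)
    qed
  qed
  have EG: "e \<in> lie_algebra G" if "e \<in> E" for e
    using E that span_base by (auto simp: is_orthonormal_basis_def)
  show ?thesis
    unfolding is_orthonormal_basis_def
  proof (intro conjI)
    show "span (Ad A ` E) = lie_algebra G"
      using E AG by (simp add: linear_span_image[OF linear_Ad] is_orthonormal_basis_def)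
    show "independent (Ad A ` E)"
      by (rule linear_independent_injective_image[OF linear_Ad])
        (use E inj in \<open>auto simp: is_orthonormal_basis_def intro: inj_on_subset\<close>)
    show "\<forall>e\<in>Ad A ` E. \<forall>f\<in>Ad A ` E. b e f = (if e = f then 1 else 0)"
      using E inj by (auto simp: is_orthonormal_basis_def b inj_eq EG)
  qed
qed

lemma inner_product_on_form: "inner_product_on UNIV (\<lambda>u v. u \<bullet> (S *v v))"
proof
  show "linear_map_on UNIV (\<lambda>v. x \<bullet> (S *v v))" for x
    by (simp add: linear_map_on_def matrix_vector_right_distrib matrix_vector_mult_scaleR
        inner_add_right)
  show "x \<bullet> (S *v y) = y \<bullet> (S *v x)" for x y
  proof -
    have "S *v x = x v* S"
      using form_symmetric transpose_matrix_vector[of S x] by simp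
    then show ?thesis using dot_lmul_matrix[of x S y] by (simp add: inner_commute)
  qed
qed (use form_positive in auto)

definition trace_form :: "'n mat \<Rightarrow> 'n mat \<Rightarrow> real" where
  "trace_form X Y = - trace (X ** Y)"

end

lemma trace_on_UNIV_eq_trace: "trace_on UNIV (\<lambda>v. A *v v) = trace (A :: 'n::finite mat)"
proof -
  interpret inner_product_on "UNIV :: (real ^ 'n) set" "(\<bullet>)"
    by unfold_locales
      (auto simp: linear_map_on_def inner_add_right inner_commute)
  have onb: "is_orthonormal_basis (\<bullet>) UNIV (Basis :: (real ^ 'n) set)"
    by (auto simp: is_orthonormal_basis_def independent_Basis inner_Basis)
  have "trace_on UNIV (\<lambda>v. A *v v) = (\<Sum>e\<in>Basis. (A *v e) \<bullet> e)"
    by (rule trace_on_eq_sum[OF onb])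
      (auto simp: linear_map_on_def matrix_vector_right_distrib matrix_vector_mult_scaleR)
  also have "\<dots> = (\<Sum>i\<in>UNIV. (A *v axis i 1) \<bullet> axis i 1)"
  proof -
    have basis: "(Basis :: (real ^ 'n) set) = range (\<lambda>i. axis i 1)"
      by (auto simp: Basis_vec_def)
    have "inj (\<lambda>i. axis i 1 :: real ^ 'n)" by (auto simp: inj_def axis_eq_axis)
    then show ?thesis unfolding basis by (subst sum.reindex) (auto simp: o_def)
  qed
  also have "\<dots> = trace A"
    by (simp add: trace_def inner_axis matrix_vector_mul_component)
  finally show ?thesis .
qed

context orthogonal_matrix_group
begin

text \<open>Positivity holds because the elements of the Lie algebra are skew for \<open>S\<close>, so that \<open>- tr (X X)\<close>
  is the sum of the squared \<open>S\<close>-norms of the vectors \<open>X e\<close>.\<close>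

lemma inner_product_on_trace_form: "inner_product_on (lie_algebra G) trace_form"
proof
  show "subspace (lie_algebra G)" by (rule subspace_lie_algebra)
  show "linear_map_on (lie_algebra G) (trace_form X)" for X
    by (simp add: linear_map_on_def trace_form_def trace_def matrix_mult.add_right
        matrix_mult.scaleR_right sum.distrib sum_distrib_left)
  show "trace_form X Y = trace_form Y X" for X Y
    unfolding trace_form_def by (simp only: trace_mul_sym[of X Y])
next
  fix X assume X: "X \<in> lie_algebra G" "X \<noteq> 0"
  interpret form: inner_product_on UNIV "\<lambda>u v. u \<bullet> (S *v v)" by (rule inner_product_on_form)
  obtain E where E: "is_orthonormal_basis (\<lambda>u v. u \<bullet> (S *v v)) UNIV E"
    using form.orthonormal_basis_exists by blast
  have skew: "(X *v u) \<bullet> (S *v v) = - (u \<bullet> (S *v (X *v v)))" for u v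
  proof -
    have "transpose X ** S = - (S ** X)"
      using lie_algebra_skew[OF X(1)] by (simp add: eq_neg_iff_add_eq_0)
    then have "u \<bullet> ((transpose X ** S) *v v) = - (u \<bullet> ((S ** X) *v v))"
      by (simp add: matrix_vector_mult_def sum_negf inner_vec_def)
    moreover have "u \<bullet> ((transpose X ** S) *v v) = (X *v u) \<bullet> (S *v v)"
      using dot_lmul_matrix[of "S *v v" X u]
      by (simp add: inner_commute flip: matrix_vector_mul_assoc)
    ultimately show ?thesis by (simp flip: matrix_vector_mul_assoc)
  qed
  have "trace (X ** X) = (\<Sum>e\<in>E. ((X ** X) *v e) \<bullet> (S *v e))"
    unfolding trace_on_UNIV_eq_trace[symmetric]
    by (rule form.trace_on_eq_sum[OF E])
      (auto simp: linear_map_on_def matrix_vector_right_distrib matrix_vector_mult_scaleR)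
  also have "\<dots> = - (\<Sum>e\<in>E. (X *v e) \<bullet> (S *v (X *v e)))"
    by (simp add: skew sum_negf flip: matrix_vector_mul_assoc)
  finally have tr: "trace_form X X = (\<Sum>e\<in>E. (X *v e) \<bullet> (S *v (X *v e)))"
    by (simp add: trace_form_def)
  obtain e where e: "e \<in> E" "X *v e \<noteq> 0"
  proof (rule ccontr)
    assume "\<not> thesis"
    then have "X *v e = 0" if "e \<in> E" for e
      using that \<open>\<And>e. e \<in> E \<Longrightarrow> X *v e \<noteq> 0 \<Longrightarrow> thesis\<close> by blast
    then have "X *v v = 0" for v
      using form.onb_linear_map_on[OF E, of "\<lambda>v. X *v v" v]
      by (simp add: linear_map_on_def matrix_vector_right_distrib matrix_vector_mult_scaleR)
    then show False using X(2) matrix_eq[of X 0] by simp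
  qed
  show "trace_form X X > 0"
    unfolding tr
    by (rule sum_pos2[OF form.onb_finite[OF E] e(1)]) (use e form.nonneg form.pos in auto)
qed

lemma trace_form_bracket: "trace_form (bracket Z X) Y = - trace_form X (bracket Z Y)"
proof -
  have "trace (Z ** X ** Y) = trace (X ** Y ** Z)"
    using trace_mul_sym[of Z "X ** Y"] by (simp add: matrix_mul_assoc)
  then show ?thesis
    by (simp add: trace_form_def bracket_def matrix_mult.diff_left matrix_mult.diff_right
        trace_sub matrix_mul_assoc)
qed

lemma trace_form_Ad:
  assumes "A \<in> G"
  shows "trace_form (Ad A X) (Ad A Y) = trace_form X Y"
proof -
  have "Ad A X ** Ad A Y = A ** (X ** Y ** matrix_inv A)"
    by (simp add: Ad_def matrix_mul_assoc matrix_inv_cancel invertible assms)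
  then show ?thesis
    using trace_mul_sym[of A "X ** Y ** matrix_inv A"]
    by (simp add: trace_form_def matrix_inv_cancel invertible assms)
qed

section \<open>The Killing form\<close>

lemma neg_killing_eq_sum:
  assumes E: "is_orthonormal_basis trace_form (lie_algebra G) E"
    and "X \<in> lie_algebra G" "Y \<in> lie_algebra G"
  shows "neg_killing G X Y = (\<Sum>e\<in>E. trace_form (bracket Y e) (bracket X e))"
proof -
  interpret T: inner_product_on "lie_algebra G" trace_form by (rule inner_product_on_trace_form)
  have "neg_killing G X Y = - (\<Sum>e\<in>E. trace_form (bracket X (bracket Y e)) e)"
    unfolding neg_killing_def killing_form_def
    using assms bracket_lie_algebra
    by (subst T.trace_on_eq_sum[OF E])
      (auto intro!: linear_map_on_compose[OF linear_map_on_bracket linear_map_on_bracket T.subspace])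
  then show ?thesis by (simp add: trace_form_bracket sum_negf)
qed

text \<open>The identity reduces to \<open>tr (ad Z (ad X ad Y)) = tr ((ad X ad Y) ad Z)\<close>.\<close>

lemma neg_killing_bracket:
  assumes "X \<in> lie_algebra G" "Y \<in> lie_algebra G" "Z \<in> lie_algebra G"
  shows "neg_killing G (bracket Z X) Y = - neg_killing G X (bracket Z Y)"
proof -
  interpret T: inner_product_on "lie_algebra G" trace_form by (rule inner_product_on_trace_form)
  obtain E where E: "is_orthonormal_basis trace_form (lie_algebra G) E"
    using T.orthonormal_basis_exists by blast
  note br = bracket_lie_algebra
  note lin = linear_map_on_compose[OF linear_map_on_bracket _ T.subspace] linear_map_on_bracket
  have lin3: "linear_map_on (lie_algebra G) (\<lambda>W. bracket P (bracket Q (bracket R W)))"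
    if "P \<in> lie_algebra G" "Q \<in> lie_algebra G" "R \<in> lie_algebra G" for P Q R
    using that by (intro lin br)
  have diff: "trace_on (lie_algebra G) (\<lambda>W. f W - g W)
      = trace_on (lie_algebra G) f - trace_on (lie_algebra G) g"
    if "linear_map_on (lie_algebra G) f" "\<And>W. W \<in> lie_algebra G \<Longrightarrow> f W \<in> lie_algebra G"
      "linear_map_on (lie_algebra G) g" "\<And>W. W \<in> lie_algebra G \<Longrightarrow> g W \<in> lie_algebra G" for f g
  proof -
    have "linear_map_on (lie_algebra G) (\<lambda>W. f W - g W)"
      using that(1,3) by (simp add: linear_map_on_def algebra_simps)
    then show ?thesis
      using that T.onb_in[OF E] subspace_diff[OF T.subspace]
      by (simp add: T.trace_on_eq_sum[OF E] T.diff_left sum_subtractf)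
  qed
  have "trace_on (lie_algebra G) (\<lambda>W. bracket Z (bracket X (bracket Y W)))
      = trace_on (lie_algebra G) (\<lambda>W. bracket X (bracket Y (bracket Z W)))"
    using assms by (intro T.trace_on_commute lin br)
  then show ?thesis
    using assms
    by (simp add: neg_killing_def killing_form_def jacobi bracket.diff_right diff lin3 br)
qed

lemma neg_killing_Ad:
  assumes A: "A \<in> G" and XY: "X \<in> lie_algebra G" "Y \<in> lie_algebra G"
  shows "neg_killing G (Ad A X) (Ad A Y) = neg_killing G X Y"
proof -
  interpret T: inner_product_on "lie_algebra G" trace_form by (rule inner_product_on_trace_form)
  obtain E where E: "is_orthonormal_basis trace_form (lie_algebra G) E"
    using T.orthonormal_basis_exists by blast
  have AE: "is_orthonormal_basis trace_form (lie_algebra G) (Ad A ` E)"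
    by (rule is_orthonormal_basis_Ad[OF A E]) (rule trace_form_Ad[OF A])
  have inj: "inj_on (Ad A) E" by (rule inj_on_inverseI) (rule Ad_inv(2)[OF A])
  have "neg_killing G (Ad A X) (Ad A Y)
      = (\<Sum>e\<in>E. trace_form (bracket (Ad A Y) (Ad A e)) (bracket (Ad A X) (Ad A e)))"
    using neg_killing_eq_sum[OF AE] XY Ad_lie_algebra[OF A]
    by (simp add: sum.reindex[OF inj])
  also have "\<dots> = neg_killing G X Y"
    using neg_killing_eq_sum[OF E] XY
    by (simp add: trace_form_Ad[OF A] flip: Ad_bracket[OF invertible[OF A]])
  finally show ?thesis .
qed

text \<open>\<open>B(X, X)\<close> is the sum of squared norms of \<open>[X, e]\<close> over an orthonormal basis, so it
  vanishes only for central \<open>X\<close>; the centre is a solvable ideal.\<close>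

lemma inner_product_on_neg_killing:
  assumes ss: "semisimple_lie (lie_algebra G)"
  shows "inner_product_on (lie_algebra G) (neg_killing G)"
proof -
  interpret T: inner_product_on "lie_algebra G" trace_form by (rule inner_product_on_trace_form)
  obtain E where E: "is_orthonormal_basis trace_form (lie_algebra G) E"
    using T.orthonormal_basis_exists by blast
  note br = bracket_lie_algebra and eq = neg_killing_eq_sum[OF E] and inE = T.onb_in[OF E]
  show ?thesis
  proof
    show "subspace (lie_algebra G)" by (rule T.subspace)
  next
    fix X assume X: "X \<in> lie_algebra G"
    show "linear_map_on (lie_algebra G) (neg_killing G X)"
      unfolding linear_map_on_def
      using X br inE T.subspace
      by (simp add: eq subspace_add subspace_scale bracket.add_left bracket.scaleR_left
          T.add_left T.scale_left sum.distrib sum_distrib_left)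
  next
    fix X Y assume "X \<in> lie_algebra G" "Y \<in> lie_algebra G"
    then show "neg_killing G X Y = neg_killing G Y X"
      using br inE by (auto simp: eq intro!: sum.cong T.sym)
  next
    fix X assume X: "X \<in> lie_algebra G" "X \<noteq> 0"
    \<comment> \<open>the centre of the Lie algebra\<close>
    define C where "C = {Z \<in> lie_algebra G. \<forall>W\<in>lie_algebra G. bracket Z W = 0}"
    have "lie_ideal (lie_algebra G) C"
      unfolding lie_ideal_def
    proof (intro conjI ballI)
      show "subspace C"
        unfolding C_def subspace_def
        using T.subspace by (auto simp: subspace_def bracket.zero_left bracket.add_left
            bracket.scaleR_left)
      show "C \<subseteq> lie_algebra G" by (auto simp: C_def)
      fix Z W assume "Z \<in> lie_algebra G" "W \<in> C"
      then have "bracket Z W = 0" by (auto simp: C_def bracket_skew[of Z W])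
      then show "bracket Z W \<in> C"
        using T.subspace by (auto simp: C_def subspace_0 bracket.zero_left)
    qed
    moreover have "solvable_lie C"
    proof -
      have "0 \<in> C" using T.subspace by (auto simp: C_def subspace_0 bracket.zero_left)
      then have "{bracket X Y |X Y. X \<in> C \<and> Y \<in> C} = {0}" by (auto simp: C_def) force
      then have "derived_series C (Suc 0) = {0}" by simp
      then show ?thesis unfolding solvable_lie_def by blast
    qed
    ultimately have "C = {0}" using ss by (auto simp: semisimple_lie_def)
    then obtain W where W: "W \<in> lie_algebra G" "bracket X W \<noteq> 0"
      using X by (auto simp: C_def)
    obtain e where e: "e \<in> E" "bracket X e \<noteq> 0"
    proof (rule ccontr)
      assume "\<not> thesis"
      then have "bracket X e = 0" if "e \<in> E" for e
        using that \<open>\<And>e. e \<in> E \<Longrightarrow> bracket X e \<noteq> 0 \<Longrightarrow> thesis\<close> by blast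
      then have "bracket X W = 0"
        using T.onb_linear_map_on[OF E linear_map_on_bracket W(1)] by simp
      then show False using W by simp
    qed
    show "neg_killing G X X > 0"
      unfolding eq[OF X(1) X(1)]
      by (rule sum_pos2[OF T.onb_finite[OF E] e(1)])
        (use T.nonneg T.pos X(1) br inE e in auto)
  qed
qed

end

section \<open>Symmetric operators\<close>

text \<open>In coordinates of a Euclidean orthonormal basis of \<open>S\<close> the map is a finite sum.\<close>

lemma continuous_on_linear_map_on:
  fixes f :: "'a::euclidean_space \<Rightarrow> 'b::real_normed_vector"
  assumes "subspace S" "linear_map_on S f"
  shows "continuous_on S f"
proof -
  interpret inner_product_on S "(\<bullet>)"
    by unfold_locales (use assms in \<open>auto simp: linear_map_on_def inner_add_right inner_commute\<close>)
  obtain E where E: "is_orthonormal_basis (\<bullet>) S E" using orthonormal_basis_exists by blast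
  have "continuous_on S (\<lambda>x. \<Sum>e\<in>E. (x \<bullet> e) *\<^sub>R f e)"
    by (intro continuous_intros)
  then show ?thesis
    using onb_linear_map_on[OF E assms(2)] by (simp cong: continuous_on_cong)
qed

text \<open>The maximum \<open>r\<close> of the Rayleigh quotient is an eigenvalue: if it is attained at \<open>x\<close>, then the
  positive semidefinite form \<open>r b(u, v) - b(C u, v)\<close> vanishes on \<open>(x, x)\<close>, hence on \<open>(x, y)\<close> for
  all \<open>y\<close>.\<close>

lemma (in inner_product_on) symmetric_eigenvector_exists:
  assumes C: "linear_map_on S C" "\<And>x. x \<in> S \<Longrightarrow> C x \<in> S"
    and symC: "\<And>x y. x \<in> S \<Longrightarrow> y \<in> S \<Longrightarrow> b (C x) y = b x (C y)"
    and nontrivial: "S \<noteq> {0}"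
  shows "\<exists>c. \<exists>x\<in>S. x \<noteq> 0 \<and> C x = c *\<^sub>R x"
proof -
  obtain E where E: "is_orthonormal_basis b S E" using orthonormal_basis_exists by blast
  define r where "r x = b (C x) x / b x x" for x
  let ?U = "S \<inter> sphere 0 1"
  have U: "x \<in> S" "x \<noteq> 0" "b x x > 0" if "x \<in> ?U" for x
  proof -
    show "x \<in> S" "x \<noteq> 0" using that by auto
    then show "b x x > 0" by (rule pos)
  qed
  have cont: "continuous_on S (\<lambda>x. b x e)" if "e \<in> S" for e
    using continuous_on_linear_map_on[OF subspace lin_left[OF that]] .
  have contC: "continuous_on S (\<lambda>x. b (C x) e)" if "e \<in> S" for e
    using continuous_on_linear_map_on[OF subspace 
        linear_map_on_compose[OF lin_left[OF that] C(1) subspace C(2)]] .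
  have "continuous_on S (\<lambda>x. \<Sum>e\<in>E. b x e * b x e)" "continuous_on S (\<lambda>x. \<Sum>e\<in>E. b (C x) e * b x e)"
    by (intro continuous_intros cont contC onb_in[OF E]; assumption)+
  then have "continuous_on S (\<lambda>x. b x x)" "continuous_on S (\<lambda>x. b (C x) x)"
    using parseval[OF E] C(2) by (simp_all cong: continuous_on_cong)
  then have "continuous_on ?U r"
    unfolding r_def
    by (intro continuous_on_divide) (auto intro: continuous_on_subset[OF _ Int_lower1] dest!: U(3))
  moreover have "compact ?U"
    by (intro closed_Int_compact closed_subspace subspace compact_sphere)
  moreover have "?U \<noteq> {}"
  proof -
    obtain x where "x \<in> S" "x \<noteq> 0" using nontrivial subspace subspace_0 by blast
    then have "(1 / norm x) *\<^sub>R x \<in> ?U" using subspace by (simp add: subspace_scale)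
    then show ?thesis by blast
  qed
  ultimately obtain x where x: "x \<in> ?U" and max: "\<And>y. y \<in> ?U \<Longrightarrow> r y \<le> r x"
    using continuous_attains_sup[of ?U r] by blast
  define h where "h u v = r x * b u v - b (C u) v" for u v
  have h_nonneg: "h y y \<ge> 0" if y: "y \<in> S" for y
  proof (cases "y = 0")
    case True
    then show ?thesis using y C(2) by (simp add: h_def zero_right)
  next
    case False
    define z where "z = (1 / norm y) *\<^sub>R y"
    have z: "z \<in> ?U" using False y subspace by (simp add: z_def subspace_scale)
    have "b (C z) z = (1 / norm y)\<^sup>2 * b (C y) y" "b z z = (1 / norm y)\<^sup>2 * b y y"
      using y C(2) linear_map_on_scaleR[OF C(1) y] subspace
      by (simp_all add: z_def scale_left scale_right subspace_scale power2_eq_square)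
    then have "r y = r z" using False by (simp add: r_def)
    then have "r y \<le> r x" using max[OF z] by simp
    then show ?thesis using pos[OF y False] by (simp add: h_def r_def divide_le_eq)
  qed
  have hxx: "h x x = 0" using U(3)[OF x] by (simp add: h_def r_def)
  have xS: "x \<in> S" using x by blast
  have "b (C x) y = b (r x *\<^sub>R x) y" if y: "y \<in> S" for y
  proof -
    have quad: "0 \<le> 2 * t * h x y + t\<^sup>2 * h y y" for t
    proof -
      have "h (x + t *\<^sub>R y) (x + t *\<^sub>R y) = h x x + 2 * t * h x y + t\<^sup>2 * h y y"
        using xS y subspace C(2) symC[OF y xS] sym[OF y xS] sym[OF C(2)[OF xS] y]
        by (simp add: h_def linear_map_on_add[OF C(1)] linear_map_on_scaleR[OF C(1)]
            add_left add_right scale_left scale_right subspace_add subspace_scale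
            power2_eq_square algebra_simps)
      then show ?thesis
        using h_nonneg[of "x + t *\<^sub>R y"] xS y subspace hxx by (simp add: subspace_add subspace_scale)
    qed
    have "h x y = 0"
    proof (rule ccontr)
      assume "h x y \<noteq> 0"
      define d where "d = h y y + 1"
      have d: "d > 0" using h_nonneg[OF y] by (simp add: d_def)
      \<comment> \<open>at \<open>t = - h(x, y) / d\<close> the quadratic is negative\<close>
      have "2 * (- h x y / d) * h x y + (- h x y / d)\<^sup>2 * h y y = (h x y / d)\<^sup>2 * (h y y - 2 * d)"
        using d by (simp add: field_simps power2_eq_square)
      also have "\<dots> < 0"
        using d \<open>h x y \<noteq> 0\<close> h_nonneg[OF y] by (intro mult_pos_neg) (auto simp: d_def)
      finally show False using quad[of "- h x y / d"] by simp
    qed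
    then show ?thesis using xS y by (simp add: h_def scale_left)
  qed
  then have "C x = r x *\<^sub>R x"
    by (intro eqI C(2) xS subspace_scale subspace)
  then show ?thesis using x U by blast
qed

section \<open>Homogeneous spaces with the Killing metric\<close>

locale killing_homogeneous_space = orthogonal_matrix_group G S
  for G :: "'n::finite mat set" and S +
  fixes K :: "'n mat set"
  assumes semisimple: "semisimple_lie (lie_algebra G)"
    and subgroup: "matrix_group K" "K \<subseteq> G"
begin

abbreviation "g \<equiv> lie_algebra G"
abbreviation "k \<equiv> lie_algebra K"
abbreviation "m \<equiv> tangent_space G K"
abbreviation "B \<equiv> neg_killing G"
abbreviation "br_m \<equiv> bracket_m G K"
abbreviation "br_k \<equiv> bracket_k G K"

sublocale B: inner_product_on g B
  by (rule inner_product_on_neg_killing[OF semisimple])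

sublocale K: orthogonal_matrix_group K S
  by unfold_locales (use subgroup form_symmetric form_positive form_invariant in auto)

lemma k_subset: "k \<subseteq> g"
  using subgroup by (auto simp: lie_algebra_def)

lemma m_eq_complement: "m = B.complement k"
  by (simp add: tangent_space_def B.complement_def)

lemma m_subset: "m \<subseteq> g"
  by (auto simp: tangent_space_def)

sublocale M: inner_product_on m B
  by (rule B.restrict)
    (use m_subset m_eq_complement
        B.subspace_complement[OF K.subspace_lie_algebra k_subset] in auto)

sublocale k: inner_product_on k B
  by (rule B.restrict[OF K.subspace_lie_algebra k_subset])

lemma in_g: "X \<in> k \<Longrightarrow> X \<in> g" "X \<in> m \<Longrightarrow> X \<in> g"
  using k_subset m_subset by auto

lemma k_m_orthogonal:
  assumes "U \<in> k" "V \<in> m"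
  shows "B V U = 0" "B U V = 0"
proof -
  show "B V U = 0" using assms by (auto simp: tangent_space_def)
  then show "B U V = 0" using assms in_g B.sym[of U V] by auto
qed

text \<open>The components along \<open>k\<close> and \<open>m\<close> exist because \<open>m\<close> is an orthogonal complement.  Together with the
  next two lemmas, nondegeneracy of \<open>B\<close> on \<open>m\<close> reduces all properties of \<open>[X, Y]\<^sub>m\<close> to those of the
  bracket.\<close>

lemma bracket_split:
  assumes "X \<in> g" "Y \<in> g"
  shows "br_k X Y \<in> k" "br_m X Y \<in> m" "br_k X Y + br_m X Y = bracket X Y"
proof -
  obtain U where U: "U \<in> k" "bracket X Y - U \<in> m"
    using B.complement_decomposition[OF K.subspace_lie_algebra k_subset bracket_lie_algebra[OF assms]]
    unfolding m_eq_complement by blast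
  have "br_k X Y = U" "br_m X Y = bracket X Y - U"
    using B.component_eq[OF K.subspace_lie_algebra k_subset U[unfolded m_eq_complement]]
      B.component_complement_eq[OF K.subspace_lie_algebra k_subset U[unfolded m_eq_complement]]
    by (simp_all add: bracket_k_def bracket_m_def m_eq_complement)
  then show "br_k X Y \<in> k" "br_m X Y \<in> m" "br_k X Y + br_m X Y = bracket X Y"
    using U by auto
qed

lemma B_br_m:
  assumes "X \<in> g" "Y \<in> g" "Z \<in> m"
  shows "B (br_m X Y) Z = B (bracket X Y) Z" "B Z (br_m X Y) = B Z (bracket X Y)"
proof -
  note s = bracket_split[OF assms(1,2)]
  show "B (br_m X Y) Z = B (bracket X Y) Z"
    using s assms(3) in_g unfolding s(3)[symmetric] by (simp add: B.add_left k_m_orthogonal)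
  show "B Z (br_m X Y) = B Z (bracket X Y)"
    using s assms(3) in_g unfolding s(3)[symmetric] by (simp add: B.add_right k_m_orthogonal)
qed

lemma B_br_k:
  assumes "X \<in> g" "Y \<in> g" "U \<in> k"
  shows "B (br_k X Y) U = B (bracket X Y) U" "B U (br_k X Y) = B U (bracket X Y)"
proof -
  note s = bracket_split[OF assms(1,2)]
  show "B (br_k X Y) U = B (bracket X Y) U"
    using s assms(3) in_g unfolding s(3)[symmetric] by (simp add: B.add_left k_m_orthogonal)
  show "B U (br_k X Y) = B U (bracket X Y)"
    using s assms(3) in_g unfolding s(3)[symmetric] by (simp add: B.add_right k_m_orthogonal)
qed

lemma br_m_in: "X \<in> m \<Longrightarrow> Y \<in> m \<Longrightarrow> br_m X Y \<in> m"
  by (rule bracket_split(2)[OF in_g(2) in_g(2)])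

lemma br_k_in: "X \<in> m \<Longrightarrow> Y \<in> m \<Longrightarrow> br_k X Y \<in> k"
  by (rule bracket_split(1)[OF in_g(2) in_g(2)])

lemma br_m_skew:
  assumes "X \<in> m" "Y \<in> m"
  shows "br_m Y X = - br_m X Y"
proof (rule M.eqI)
  show "br_m Y X \<in> m" "- br_m X Y \<in> m"
    using assms br_m_in M.subspace subspace_neg by blast+
  show "B (br_m Y X) Z = B (- br_m X Y) Z" if "Z \<in> m" for Z
    using assms that in_g br_m_in bracket_lie_algebra bracket_skew[of X Y]
    by (simp add: M.minus_left B_br_m B.minus_left)
qed

lemma br_m_self:
  assumes "X \<in> m"
  shows "br_m X X = 0"
  by (rule M.eqI)
    (use assms in_g br_m_in M.subspace in \<open>auto simp: B_br_m bracket_self subspace_0\<close>)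

lemma linear_map_on_br_m:
  assumes "X \<in> m"
  shows "linear_map_on m (br_m X)" "linear_map_on m (\<lambda>Y. br_m Y X)"
proof -
  show "linear_map_on m (br_m X)"
    unfolding linear_map_on_def
  proof (intro ballI allI)
    fix Y Z :: "'n mat" and a c :: real assume YZ: "Y \<in> m" "Z \<in> m"
    have YZ': "a *\<^sub>R Y + c *\<^sub>R Z \<in> m" "a *\<^sub>R br_m X Y \<in> m" "c *\<^sub>R br_m X Z \<in> m"
      using assms YZ br_m_in M.subspace by (auto simp: subspace_add subspace_scale)
    show "br_m X (a *\<^sub>R Y + c *\<^sub>R Z) = a *\<^sub>R br_m X Y + c *\<^sub>R br_m X Z"
    proof (rule M.eqI)
      show "br_m X (a *\<^sub>R Y + c *\<^sub>R Z) \<in> m" "a *\<^sub>R br_m X Y + c *\<^sub>R br_m X Z \<in> m"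
        using assms YZ' br_m_in M.subspace by (auto simp: subspace_add)
      fix W assume W: "W \<in> m"
      show "B (br_m X (a *\<^sub>R Y + c *\<^sub>R Z)) W = B (a *\<^sub>R br_m X Y + c *\<^sub>R br_m X Z) W"
        using assms W YZ YZ' in_g br_m_in bracket_lie_algebra B.subspace
        by (simp add: B_br_m M.add_left M.scale_left bracket.add_right bracket.scaleR_right
            B.add_left B.scale_left subspace_scale)
    qed
  qed
  then have "linear_map_on m (\<lambda>Y. - br_m X Y)"
    by (simp add: linear_map_on_def)
  moreover have "br_m Y X = - br_m X Y" if "Y \<in> m" for Y
    using br_m_skew[OF assms that] .
  ultimately show "linear_map_on m (\<lambda>Y. br_m Y X)"
    using M.subspace by (simp add: linear_map_on_def subspace_add subspace_scale)
qed

lemma B_br_m_skew: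
  assumes "X \<in> m" "Y \<in> m" "Z \<in> m"
  shows "B (br_m X Y) Z = - B Y (br_m X Z)"
proof -
  note g = assms[THEN in_g(2)]
  show ?thesis
    unfolding B_br_m(1)[OF g(1,2) assms(3)] B_br_m(2)[OF g(1,3) assms(2)]
    by (rule neg_killing_bracket[OF g(2,3,1)])
qed

lemma Ad_m:
  assumes A: "A \<in> K" and X: "X \<in> m"
  shows "Ad A X \<in> m"
proof -
  have AG: "A \<in> G" using A subgroup by blast
  have "B (Ad A X) Y = 0" if Y: "Y \<in> k" for Y
  proof -
    have Y': "Ad (matrix_inv A) Y \<in> k"
      by (rule K.Ad_lie_algebra[OF matrix_group_inv[OF subgroup(1) A] Y])
    have "B (Ad A X) (Ad A (Ad (matrix_inv A) Y)) = B X (Ad (matrix_inv A) Y)"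
      by (rule neg_killing_Ad[OF AG in_g(2)[OF X] in_g(1)[OF Y']])
    also have "\<dots> = 0" by (rule k_m_orthogonal(1)[OF Y' X])
    finally show ?thesis by (simp add: Ad_inv(1)[OF AG])
  qed
  moreover have "Ad A X \<in> g" by (rule Ad_lie_algebra[OF AG in_g(2)[OF X]])
  ultimately show ?thesis unfolding tangent_space_def by blast
qed

lemma br_m_Ad:
  assumes A: "A \<in> K" and XY: "X \<in> m" "Y \<in> m"
  shows "br_m (Ad A X) (Ad A Y) = Ad A (br_m X Y)"
proof (rule M.eqI)
  have AG: "A \<in> G" using A subgroup by blast
  have A': "matrix_inv A \<in> K" by (rule matrix_group_inv[OF subgroup(1) A])
  show "br_m (Ad A X) (Ad A Y) \<in> m" "Ad A (br_m X Y) \<in> m"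
    using Ad_m[OF A] br_m_in XY by auto
  fix Z assume Z: "Z \<in> m"
  define W where "W = Ad (matrix_inv A) Z"
  have W: "W \<in> m" "Ad A W = Z"
    using Ad_m[OF A' Z] Ad_inv(1)[OF AG] by (auto simp: W_def)
  have "B (br_m (Ad A X) (Ad A Y)) Z = B (Ad A (bracket X Y)) (Ad A W)"
    using XY Z W Ad_m[OF A] in_g by (simp add: B_br_m Ad_bracket[OF invertible[OF AG]])
  also have "\<dots> = B (Ad A (br_m X Y)) (Ad A W)"
    using XY W(1) in_g br_m_in bracket_lie_algebra by (simp add: neg_killing_Ad[OF AG] B_br_m)
  finally show "B (br_m (Ad A X) (Ad A Y)) Z = B (Ad A (br_m X Y)) Z"
    using W by simp
qed

lemma invariant_metric_B: "invariant_metric G K B"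
  unfolding invariant_metric_def Let_def
  using M.lin M.sym M.pos neg_killing_Ad subgroup in_g by auto

lemma nabla_s_in: "X \<in> m \<Longrightarrow> Y \<in> m \<Longrightarrow> nabla_s G K s X Y \<in> m"
  using br_m_in M.subspace by (simp add: nabla_s_def subspace_scale)

lemma metric_connection_nabla_s: "metric_connection G K B (nabla_s G K s)"
proof -
  have "nomizu_map G K (nabla_s G K s)"
    unfolding nomizu_map_def Let_def
  proof (intro conjI ballI)
    fix X Y assume X: "X \<in> m"
    show "linear_map_on m (nabla_s G K s X)" "linear_map_on m (\<lambda>Y. nabla_s G K s Y X)"
      using linear_map_on_br_m[OF X]
      by (auto simp: linear_map_on_def nabla_s_def scaleR_add_right mult.commute)
    assume "Y \<in> m"
    then show "nabla_s G K s X Y \<in> m" using X by (rule nabla_s_in[rotated])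
  qed (simp add: nabla_s_def br_m_Ad linear_scale[OF linear_Ad])
  then show ?thesis
    unfolding metric_connection_def Let_def
    by (simp add: nabla_s_def M.scale_left M.scale_right br_m_in B_br_m_skew)
qed

lemma torsion_nabla_s:
  assumes "X \<in> m" "Y \<in> m"
  shows "torsion G K (nabla_s G K s) X Y = (s - 1) *\<^sub>R br_m X Y"
  using br_m_skew[OF assms]
  by (simp add: torsion_def nabla_s_def algebra_simps flip: scaleR_add_left)

lemma skew_torsion_nabla_s: "skew_torsion G K B (nabla_s G K s)"
  unfolding skew_torsion_def three_form_on_def
proof (intro ballI conjI)
  fix X Y Z assume X: "X \<in> m" and Y: "Y \<in> m"
  note eq = torsion_nabla_s br_m_in M.scale_left
  have "linear_map_on m (B ((s - 1) *\<^sub>R br_m X Y))"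
    by (intro M.lin subspace_scale M.subspace br_m_in X Y)
  then show "linear_map_on m (\<lambda>Z. B (torsion G K (nabla_s G K s) X Y) Z)"
    by (simp add: torsion_nabla_s X Y)
  assume Z: "Z \<in> m"
  show "B (torsion G K (nabla_s G K s) Y X) Z = - B (torsion G K (nabla_s G K s) X Y) Z"
    using X Y Z br_m_skew[OF X Y] by (simp add: eq M.minus_left M.subspace subspace_scale)
  show "B (torsion G K (nabla_s G K s) X Z) Y = - B (torsion G K (nabla_s G K s) X Y) Z"
    using X Y Z M.sym[OF br_m_in[OF X Z] Y] B_br_m_skew[OF X Y Z] by (simp add: eq)
qed

text \<open>The difference of two metric connections with the same torsion is a tensor \<open>t(X, Y, Z)\<close>
  that is symmetric in \<open>X, Y\<close> and skew in \<open>Y, Z\<close>, hence zero.\<close>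

lemma levi_civita_unique:
  assumes LC: "levi_civita G K B \<Lambda>" and XY: "X \<in> m" "Y \<in> m"
  shows "\<Lambda> X Y = nabla_s G K 1 X Y"
proof -
  let ?N = "nabla_s G K 1"
  define D where "D U V = \<Lambda> U V - ?N U V" for U V
  have metric: "B (\<Lambda> U V) W + B V (\<Lambda> U W) = 0" if "U \<in> m" "V \<in> m" "W \<in> m" for U V W
    using LC that by (auto simp: levi_civita_def metric_connection_def Let_def)
  have metricN: "B (?N U V) W + B V (?N U W) = 0" if "U \<in> m" "V \<in> m" "W \<in> m" for U V W
    using metric_connection_nabla_s[of 1] that by (auto simp: metric_connection_def Let_def)
  have \<Lambda>_in: "\<Lambda> U V \<in> m" if "U \<in> m" "V \<in> m" for U V
    using LC that by (auto simp: levi_civita_def metric_connection_def nomizu_map_def Let_def)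
  have D_in: "D U V \<in> m" if "U \<in> m" "V \<in> m" for U V
    unfolding D_def using that \<Lambda>_in nabla_s_in M.subspace by (intro subspace_diff)
  have D_sym: "D U V = D V U" if "U \<in> m" "V \<in> m" for U V
  proof -
    have "torsion G K \<Lambda> U V = 0" "torsion G K ?N U V = 0"
      using LC that torsion_nabla_s[OF that, of 1] by (auto simp: levi_civita_def nonzero_torsion_def)
    then show ?thesis by (simp add: D_def torsion_def algebra_simps)
  qed
  have D_skew: "B (D U V) W = - B (D U W) V" if "U \<in> m" "V \<in> m" "W \<in> m" for U V W
  proof -
    have "B (D U V) W = B (\<Lambda> U V) W - B (?N U V) W" "B (D U W) V = B (\<Lambda> U W) V - B (?N U W) V"
      unfolding D_def using that \<Lambda>_in nabla_s_in by (simp_all add: M.diff_left)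
    moreover have "B (\<Lambda> U W) V = B V (\<Lambda> U W)" "B (?N U W) V = B V (?N U W)"
      using that \<Lambda>_in nabla_s_in M.sym by auto
    ultimately show ?thesis using metric[OF that] metricN[OF that] by linarith
  qed
  have "B (D X Y) Z = B 0 Z" if Z: "Z \<in> m" for Z
  proof -
    have "B (D X Y) Z = - B (D Z X) Y"
      using D_skew[OF XY Z] D_sym[OF XY(1) Z] by simp
    also have "\<dots> = B (D Y Z) X"
      using D_skew[OF Z XY(1) XY(2)] D_sym[OF Z XY(2)] by simp
    also have "\<dots> = - B (D X Y) Z"
      using D_skew[OF XY(2) Z XY(1)] D_sym[OF XY] by simp
    finally show ?thesis using Z by (simp add: M.zero_left)
  qed
  then have "D X Y = 0"
    by (intro M.eqI D_in XY) (auto simp: M.subspace subspace_0)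
  then show ?thesis by (simp add: D_def)
qed

lemma levi_civita_nabla_s: "levi_civita G K B (nabla_s G K 1)"
  using metric_connection_nabla_s torsion_nabla_s[where s = 1]
  by (simp add: levi_civita_def nonzero_torsion_def)

section \<open>The Casimir operator and the Ricci tensor\<close>

abbreviation "E \<equiv> orthonormal_basis B m"
abbreviation "H \<equiv> orthonormal_basis B k"
abbreviation "C \<equiv> casimir_operator G K"

lemmas E_in = M.onb_in[OF M.orthonormal_basis]
lemmas H_in = k.onb_in[OF k.orthonormal_basis]

text \<open>The definition uses an arbitrary basis of \<open>k\<close> with its dual basis; any orthonormal basis gives the
  same operator.\<close>

lemma casimir_operator_eq:
  assumes "is_orthonormal_basis B k F"
  shows "C X = - (\<Sum>h\<in>F. bracket h (bracket h X))"
proof -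
  note basis = basis_of_properties[OF k.subspace]
  have "(\<Sum>e\<in>basis_of k. bracket e (bracket (dual_vector B k (basis_of k) e) X))
      = (\<Sum>h\<in>F. bracket h (bracket h X))"
    using k.dual_vector[OF basis(1,2)]
    by (intro k.contraction_dual_basis[OF assms basis(1,2)])
      (auto simp: linear_map_on_def bracket.add_left bracket.add_right bracket.scaleR_left
        bracket.scaleR_right)
  then show ?thesis by (simp add: casimir_operator_def Let_def)
qed

lemmas casimir_operator_eq_sum = casimir_operator_eq[OF k.orthonormal_basis]

lemma linear_map_on_casimir: "linear_map_on V C"
  by (rule linear_map_on_linear, rule linearI)
    (simp_all add: casimir_operator_eq_sum bracket.add_right bracket.scaleR_right sum.distrib
      scaleR_sum_right)

lemma casimir_in:
  assumes "subspace V" "\<And>U X. U \<in> k \<Longrightarrow> X \<in> V \<Longrightarrow> bracket U X \<in> V" "X \<in> V"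
  shows "C X \<in> V"
  unfolding casimir_operator_eq_sum
  using assms H_in by (intro subspace_neg subspace_sum) auto

lemma bracket_k_m:
  assumes U: "U \<in> k" and X: "X \<in> m"
  shows "bracket U X \<in> m"
proof -
  have "B (bracket U X) Z = 0" if Z: "Z \<in> k" for Z
  proof -
    have "B (bracket U X) Z = - B X (bracket U Z)"
      by (rule neg_killing_bracket[OF in_g(2)[OF X] in_g(1)[OF Z] in_g(1)[OF U]])
    also have "\<dots> = 0" using k_m_orthogonal(1)[OF K.bracket_lie_algebra[OF U Z] X] by simp
    finally show ?thesis .
  qed
  moreover have "bracket U X \<in> g" by (rule bracket_lie_algebra[OF in_g(1)[OF U] in_g(2)[OF X]])
  ultimately show ?thesis unfolding tangent_space_def by blast
qed

lemma casimir_m: "X \<in> m \<Longrightarrow> C X \<in> m"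
  using casimir_in[OF M.subspace bracket_k_m] .

text \<open>\<open>Ad(A)\<close> carries one orthonormal basis of \<open>k\<close> to another, and \<open>C\<close> can be computed in either.\<close>

lemma casimir_Ad:
  assumes A: "A \<in> K"
  shows "C (Ad A X) = Ad A (C X)"
proof -
  have AG: "A \<in> G" using A subgroup by blast
  have inj: "inj_on (Ad A) H" by (rule inj_on_inverseI) (rule Ad_inv(2)[OF AG])
  have onb: "is_orthonormal_basis B k (Ad A ` H)"
    by (rule K.is_orthonormal_basis_Ad[OF A k.orthonormal_basis])
      (use in_g in \<open>simp add: neg_killing_Ad[OF AG]\<close>)
  show ?thesis
    unfolding casimir_operator_eq[OF onb, of "Ad A X"] casimir_operator_eq_sum[of X]
    by (simp add: sum.reindex[OF inj] linear_neg[OF linear_Ad] linear_sum[OF linear_Ad]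
        Ad_bracket[OF invertible[OF AG]])
qed

lemma B_casimir:
  assumes "X \<in> m" "Y \<in> m"
  shows "B (C X) Y = (\<Sum>h\<in>H. B (bracket h X) (bracket h Y))"
proof -
  have br: "bracket h X \<in> m" "bracket h (bracket h X) \<in> m" if "h \<in> H" for h
    using that assms H_in bracket_k_m by auto
  have "B (C X) Y = - B (\<Sum>h\<in>H. bracket h (bracket h X)) Y"
    unfolding casimir_operator_eq_sum
    using assms br by (intro M.minus_left subspace_sum M.subspace)
  also have "\<dots> = - (\<Sum>h\<in>H. B (bracket h (bracket h X)) Y)"
    using M.sum_left[OF assms(2) k.onb_finite[OF k.orthonormal_basis],
        of "\<lambda>h. bracket h (bracket h X)" "\<lambda>_. 1"]
      br by simp
  also have "\<dots> = (\<Sum>h\<in>H. B (bracket h X) (bracket h Y))"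
    unfolding sum_negf[symmetric]
    using assms br H_in in_g by (intro sum.cong refl) (simp add: neg_killing_bracket)
  finally show ?thesis .
qed

lemma casimir_symmetric:
  assumes "X \<in> m" "Y \<in> m"
  shows "B (C X) Y = B X (C Y)"
proof -
  have "B (C X) Y = B (C Y) X"
    using assms bracket_k_m H_in by (auto simp: B_casimir intro!: sum.cong M.sym)
  then show ?thesis using M.sym assms casimir_m by metis
qed

text \<open>Both sides are the sum of \<open>B([X, e], h) B([Y, e], h)\<close> over \<open>e \<in> E\<close> and \<open>h \<in> H\<close>, summed in the
  two possible orders.\<close>

lemma sum_br_k_eq_casimir:
  assumes "X \<in> m" "Y \<in> m"
  shows "(\<Sum>e\<in>E. B (br_k X e) (br_k Y e)) = B (C X) Y"
proof -
  have "B (br_k X e) h = B (bracket h X) e" if "X \<in> m" "e \<in> E" "h \<in> H" for X e h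
  proof -
    have in': "X \<in> g" "e \<in> g" "h \<in> g" "h \<in> k" using that E_in H_in in_g by auto
    have "B (br_k X e) h = - B (bracket e X) h"
      using in' bracket_lie_algebra by (simp add: B_br_k bracket_skew[of e X] B.minus_left)
    also have "\<dots> = B X (bracket e h)" using in' by (simp add: neg_killing_bracket)
    also have "\<dots> = - B X (bracket h e)"
      using in' bracket_lie_algebra by (simp add: bracket_skew[of h e] B.minus_right)
    also have "\<dots> = B (bracket h X) e" using in' by (simp add: neg_killing_bracket)
    finally show ?thesis .
  qed
  note swap = this
  have "(\<Sum>e\<in>E. B (br_k X e) (br_k Y e)) = (\<Sum>e\<in>E. \<Sum>h\<in>H. B (br_k X e) h * B (br_k Y e) h)"
    by (intro sum.cong refl k.parseval[OF k.orthonormal_basis] br_k_in assms E_in)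
  also have "\<dots> = (\<Sum>h\<in>H. \<Sum>e\<in>E. B (bracket h X) e * B (bracket h Y) e)"
    by (subst sum.swap) (simp add: swap assms)
  also have "\<dots> = (\<Sum>h\<in>H. B (bracket h X) (bracket h Y))"
    by (intro sum.cong refl M.parseval[OF M.orthonormal_basis, symmetric] bracket_k_m assms H_in)
  finally show ?thesis using assms by (simp add: B_casimir)
qed

text \<open>Evaluate the trace defining \<open>B(X, Y)\<close> in the orthonormal basis \<open>H \<union> E\<close> of \<open>g\<close>.  The part
  over \<open>H\<close> is \<open>B(C X, Y)\<close>, and the \<open>k\<close>-components in the part over \<open>E\<close> contribute it once more.\<close>

lemma sum_br_m_eq:
  assumes "X \<in> m" "Y \<in> m"
  shows "(\<Sum>e\<in>E. B (br_m X e) (br_m Y e)) = B X Y - 2 * B (C X) Y"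
proof -
  have onb: "is_orthonormal_basis B g (H \<union> E)" "H \<inter> E = {}"
    using B.orthonormal_basis_Un_complement[OF k.subspace k_subset k.orthonormal_basis]
      M.orthonormal_basis unfolding m_eq_complement by auto
  have XY: "X \<in> g" "Y \<in> g" using assms in_g by auto
  have "B X Y = - (\<Sum>f\<in>H \<union> E. B (bracket X (bracket Y f)) f)"
    unfolding neg_killing_def[of G X Y] killing_form_def
    using XY bracket_lie_algebra
    by (subst B.trace_on_eq_sum[OF onb(1)])
      (auto intro!: linear_map_on_compose[OF linear_map_on_bracket linear_map_on_bracket B.subspace])
  also have "\<dots> = (\<Sum>f\<in>H \<union> E. B (bracket X f) (bracket Y f))"
    unfolding sum_negf[symmetric]
  proof (intro sum.cong refl)
    fix f assume "f \<in> H \<union> E"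
    then have "f \<in> g" using B.onb_in[OF onb(1)] by blast
    then show "- B (bracket X (bracket Y f)) f = B (bracket X f) (bracket Y f)"
      using XY bracket_lie_algebra B.sym[of "bracket Y f" "bracket X f"]
      by (simp add: neg_killing_bracket)
  qed
  also have "\<dots> = (\<Sum>h\<in>H. B (bracket X h) (bracket Y h)) + (\<Sum>e\<in>E. B (bracket X e) (bracket Y e))"
    using onb(2) k.onb_finite[OF k.orthonormal_basis] M.onb_finite[OF M.orthonormal_basis]
    by (rule sum.union_disjoint[rotated 2])
  also have "(\<Sum>h\<in>H. B (bracket X h) (bracket Y h)) = B (C X) Y"
    unfolding B_casimir[OF assms]
  proof (intro sum.cong refl)
    fix h assume "h \<in> H"
    then have "bracket h X \<in> m" "bracket h Y \<in> m" using assms H_in bracket_k_m by auto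
    then show "B (bracket X h) (bracket Y h) = B (bracket h X) (bracket h Y)"
      using M.subspace by (simp add: bracket_skew[of X h] bracket_skew[of Y h] M.minus_left M.minus_right
          subspace_neg)
  qed
  also have "(\<Sum>e\<in>E. B (bracket X e) (bracket Y e))
      = (\<Sum>e\<in>E. B (br_k X e) (br_k Y e)) + (\<Sum>e\<in>E. B (br_m X e) (br_m Y e))"
    unfolding sum.distrib[symmetric]
  proof (intro sum.cong refl)
    fix e assume e: "e \<in> E"
    note in' = assms[THEN in_g(2)] in_g(2)[OF E_in[OF e]]
    note split = bracket_split[OF in'(1,3)] bracket_split[OF in'(2,3)]
    show "B (bracket X e) (bracket Y e) = B (br_k X e) (br_k Y e) + B (br_m X e) (br_m Y e)"
      unfolding split(3)[symmetric] split(6)[symmetric]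
      using split(1,2,4,5) in_g B.subspace
      by (simp add: B.add_left B.add_right subspace_add k_m_orthogonal)
  qed
  finally show ?thesis by (simp add: sum_br_k_eq_casimir[OF assms])
qed

text \<open>The curvature formula expresses \<open>Ric\<close> through the two sums just computed, with the
  coefficient \<open>s/2 - s\<^sup>2/4\<close>, written \<open>(1 - (s - 1)\<^sup>2)/4\<close> here, on the \<open>m\<close>-part.\<close>

lemma ricci_nabla_s:
  assumes "X \<in> m" "Y \<in> m"
  shows "ricci G K B (nabla_s G K s) X Y
    = (1 - (s - 1)\<^sup>2) / 4 * B X Y + (1 + (s - 1)\<^sup>2) / 2 * B (C X) Y"
proof -
  have "B (curvature G K (nabla_s G K s) X e e) Y
      = (1 - (s - 1)\<^sup>2) / 4 * B (br_m X e) (br_m Y e) + B (br_k X e) (br_k Y e)" if "e \<in> E" for e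
  proof -
    have e: "e \<in> m" using that by (rule E_in)
    note in' = br_m_in[OF assms(1) e] br_k_in[OF assms(1) e] br_m_in[OF e br_m_in[OF assms(1) e]]
      br_m_in[OF br_m_in[OF assms(1) e] e] bracket_k_m[OF br_k_in[OF assms(1) e] e]
    have zero: "br_m X 0 = 0"
      using linear_map_on_scaleR[OF linear_map_on_br_m(1)[OF assms(1)] e, of 0] by simp
    have scale: "br_m e ((s / 2) *\<^sub>R br_m X e) = (s / 2) *\<^sub>R br_m e (br_m X e)"
      by (rule linear_map_on_scaleR[OF linear_map_on_br_m(1)[OF e] in'(1)])
    have "curvature G K (nabla_s G K s) X e e
        = - ((s / 2) * (s / 2)) *\<^sub>R br_m e (br_m X e) - (s / 2) *\<^sub>R br_m (br_m X e) e - bracket (br_k X e) e"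
      by (simp add: curvature_def nabla_s_def br_m_self[OF e] zero scale)
    also have "\<dots> = (s / 2 - s\<^sup>2 / 4) *\<^sub>R br_m e (br_m X e) - bracket (br_k X e) e"
      by (simp add: br_m_skew[OF e in'(1)] power2_eq_square algebra_simps)
    finally have "B (curvature G K (nabla_s G K s) X e e) Y
        = (s / 2 - s\<^sup>2 / 4) * B (br_m e (br_m X e)) Y - B (bracket (br_k X e) e) Y"
      using in' assms(2) M.subspace by (simp add: M.diff_left M.scale_left subspace_scale)
    moreover have "B (br_m e (br_m X e)) Y = B (br_m X e) (br_m Y e)"
      using B_br_m_skew[OF e in'(1) assms(2)] br_m_skew[OF assms(2) e] in'(1) br_m_in[OF assms(2) e]
      by (simp add: M.minus_right)
    moreover have "B (bracket (br_k X e) e) Y = - B (br_k X e) (br_k Y e)"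
    proof -
      have g': "br_k X e \<in> g" "e \<in> g" "Y \<in> g" using in' e assms in_g by auto
      have "B (bracket (br_k X e) e) Y = - B (bracket e (br_k X e)) Y"
        using g' bracket_lie_algebra by (simp add: bracket_skew[of e "br_k X e"] B.minus_left)
      also have "\<dots> = B (br_k X e) (bracket e Y)" using g' by (simp add: neg_killing_bracket)
      also have "\<dots> = - B (br_k X e) (bracket Y e)"
        using g' bracket_lie_algebra by (simp add: bracket_skew[of Y e] B.minus_right)
      finally show ?thesis using g' in' by (simp add: B_br_k)
    qed
    ultimately show ?thesis by (simp add: power2_eq_square field_simps)
  qed
  then have "ricci G K B (nabla_s G K s) X Y
      = (1 - (s - 1)\<^sup>2) / 4 * (\<Sum>e\<in>E. B (br_m X e) (br_m Y e)) + (\<Sum>e\<in>E. B (br_k X e) (br_k Y e))"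
    by (simp add: ricci_def sum.distrib sum_distrib_left)
  then show ?thesis
    by (simp add: sum_br_k_eq_casimir sum_br_m_eq assms field_simps)
qed

text \<open>The coefficient of \<open>B(C X, Y)\<close> in the Ricci tensor is positive for every \<open>s\<close>, so the equation
  can be solved for \<open>C X\<close>.\<close>

lemma ricci_nabla_s_multiple_iff:
  "(\<exists>c. \<forall>X\<in>m. \<forall>Y\<in>m. ricci G K B (nabla_s G K s) X Y = c * B X Y)
    \<longleftrightarrow> (\<exists>c. \<forall>X\<in>m. C X = c *\<^sub>R X)"
proof
  define p where "p = (1 - (s - 1)\<^sup>2) / 4"
  define q where "q = (1 + (s - 1)\<^sup>2) / 2"
  have q: "q > 0" unfolding q_def by (simp add: add_pos_nonneg)
  have ric: "ricci G K B (nabla_s G K s) X Y = p * B X Y + q * B (C X) Y" if "X \<in> m" "Y \<in> m" for X Y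
    unfolding p_def q_def using ricci_nabla_s that .
  {
    assume "\<exists>c. \<forall>X\<in>m. \<forall>Y\<in>m. ricci G K B (nabla_s G K s) X Y = c * B X Y"
    then obtain c where "\<forall>X\<in>m. \<forall>Y\<in>m. ricci G K B (nabla_s G K s) X Y = c * B X Y" by blast
    then have c: "p * B X Y + q * B (C X) Y = c * B X Y" if "X \<in> m" "Y \<in> m" for X Y
      using ric[OF that] that by simp
    have "C X = ((c - p) / q) *\<^sub>R X" if X: "X \<in> m" for X
    proof (rule M.eqI)
      show "C X \<in> m" "((c - p) / q) *\<^sub>R X \<in> m"
        using X casimir_m M.subspace by (auto simp: subspace_scale)
      fix Y assume "Y \<in> m"
      then show "B (C X) Y = B (((c - p) / q) *\<^sub>R X) Y"
        using c[OF X, of Y] q X by (simp add: M.scale_left field_simps)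
    qed
    then show "\<exists>c. \<forall>X\<in>m. C X = c *\<^sub>R X" by blast
  next
    assume "\<exists>c. \<forall>X\<in>m. C X = c *\<^sub>R X"
    then obtain c where c: "\<And>X. X \<in> m \<Longrightarrow> C X = c *\<^sub>R X" by blast
    have "ricci G K B (nabla_s G K s) X Y = (p + q * c) * B X Y" if "X \<in> m" "Y \<in> m" for X Y
      using that by (simp add: ric c M.scale_left algebra_simps)
    then show "\<exists>c. \<forall>X\<in>m. \<forall>Y\<in>m. ricci G K B (nabla_s G K s) X Y = c * B X Y" by blast
  }
qed

lemma nabla_einstein_iff:
  assumes "dim m \<noteq> 0"
  shows "nabla_einstein G K B (nabla_s G K s) \<longleftrightarrow> (\<exists>c. \<forall>X\<in>m. C X = c *\<^sub>R X)"
proof -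
  let ?ric = "ricci G K B (nabla_s G K s)"
  have onb: "is_orthonormal_basis B m E" by (rule M.orthonormal_basis)
  have sym: "ricci_sym G K B (nabla_s G K s) X Y = ?ric X Y" if "X \<in> m" "Y \<in> m" for X Y
    using that M.sym[OF that] casimir_symmetric[OF that] M.sym[OF that(1) casimir_m[OF that(2)]]
    by (simp add: ricci_sym_def ricci_nabla_s)
  have "scal G K B (nabla_s G K s) / real (dim m) = c"
    if "\<And>X Y. X \<in> m \<Longrightarrow> Y \<in> m \<Longrightarrow> ?ric X Y = c * B X Y" for c
  proof -
    have "scal G K B (nabla_s G K s) = (\<Sum>e\<in>E. c)"
      unfolding scal_def
      using onb by (intro sum.cong refl) (simp add: that E_in is_orthonormal_basis_def)
    moreover have "card E = dim m"
      using onb dim_span_eq_card_independent[of E] by (simp add: is_orthonormal_basis_def)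
    ultimately show ?thesis using assms by simp
  qed
  moreover have "nabla_einstein G K B (nabla_s G K s) \<longleftrightarrow>
      (\<forall>X\<in>m. \<forall>Y\<in>m. ?ric X Y = scal G K B (nabla_s G K s) / real (dim m) * B X Y)"
    unfolding nabla_einstein_def Let_def
    using invariant_metric_B metric_connection_nabla_s skew_torsion_nabla_s
    by (simp add: sym cong: ball_cong)
  ultimately have "nabla_einstein G K B (nabla_s G K s)
      \<longleftrightarrow> (\<exists>c. \<forall>X\<in>m. \<forall>Y\<in>m. ?ric X Y = c * B X Y)"
    by metis
  then show ?thesis by (simp only: ricci_nabla_s_multiple_iff)
qed

lemma invariant_einstein_metric_iff:
  "invariant_einstein_metric G K B \<longleftrightarrow> (\<exists>c. \<forall>X\<in>m. C X = c *\<^sub>R X)"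
proof -
  have ricci_eq: "ricci G K B \<Lambda> X Y = ricci G K B (nabla_s G K 1) X Y"
    if LC: "levi_civita G K B \<Lambda>" and X: "X \<in> m" for \<Lambda> X Y
  proof -
    note unique = levi_civita_unique[OF LC]
    have "curvature G K \<Lambda> X e e = curvature G K (nabla_s G K 1) X e e" if "e \<in> E" for e
    proof -
      have e: "e \<in> m" using that by (rule E_in)
      show ?thesis
        unfolding curvature_def
        by (simp only: unique[OF X e] unique[OF e e] unique[OF X nabla_s_in[OF e e]]
            unique[OF e nabla_s_in[OF X e]] unique[OF br_m_in[OF X e] e])
    qed
    then show ?thesis by (simp add: ricci_def)
  qed
  have "invariant_einstein_metric G K B
      \<longleftrightarrow> (\<exists>c. \<forall>X\<in>m. \<forall>Y\<in>m. ricci G K B (nabla_s G K 1) X Y = c * B X Y)"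
  proof
    assume "invariant_einstein_metric G K B"
    then obtain \<Lambda> c where "levi_civita G K B \<Lambda>" "\<forall>X\<in>m. \<forall>Y\<in>m. ricci G K B \<Lambda> X Y = c * B X Y"
      unfolding invariant_einstein_metric_def by blast
    then show "\<exists>c. \<forall>X\<in>m. \<forall>Y\<in>m. ricci G K B (nabla_s G K 1) X Y = c * B X Y"
      using ricci_eq by (intro exI[of _ c]) simp
  next
    assume "\<exists>c. \<forall>X\<in>m. \<forall>Y\<in>m. ricci G K B (nabla_s G K 1) X Y = c * B X Y"
    then show "invariant_einstein_metric G K B"
      unfolding invariant_einstein_metric_def
      using invariant_metric_B levi_civita_nabla_s by blast
  qed
  then show ?thesis by (simp only: ricci_nabla_s_multiple_iff)
qed

text \<open>The Casimir operator is symmetric and so has an eigenvector in \<open>V\<close>.  It commutes with \<open>Ad(K)\<close>, so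
  the eigenspace is a submodule, which is all of \<open>V\<close> by irreducibility.\<close>

lemma casimir_constant:
  assumes irr: "irreducible_module K V" and Vm: "V \<subseteq> m"
    and kV: "\<And>U X. U \<in> k \<Longrightarrow> X \<in> V \<Longrightarrow> bracket U X \<in> V"
    and X: "X \<in> V"
  shows "C X = casimir_constant G K V *\<^sub>R X"
proof -
  have V: "subspace V" "V \<noteq> {0}" and AdV: "\<And>A X. A \<in> K \<Longrightarrow> X \<in> V \<Longrightarrow> Ad A X \<in> V"
    using irr by (auto simp: irreducible_module_def submodule_def)
  interpret V: inner_product_on V B using V(1) Vm by (rule M.restrict)
  obtain c x where x: "x \<in> V" "x \<noteq> 0" "C x = c *\<^sub>R x"
    using V.symmetric_eigenvector_exists[OF linear_map_on_casimir casimir_in[OF V(1) kV] _ V(2)]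
      casimir_symmetric Vm by blast
  define W where "W = {Y \<in> V. C Y = c *\<^sub>R Y}"
  have "submodule K W"
    unfolding submodule_def
  proof (intro conjI ballI)
    show "subspace W"
      using V(1) linear_map_on_add[OF linear_map_on_casimir[of UNIV]]
        linear_map_on_scaleR[OF linear_map_on_casimir[of UNIV]]
        linear_map_on_scaleR[OF linear_map_on_casimir[of UNIV], of 0 0]
      by (auto simp: W_def subspace_def scaleR_add_right mult.commute)
    fix A Y assume "A \<in> K" "Y \<in> W"
    then show "Ad A Y \<in> W"
      using AdV by (simp add: W_def casimir_Ad linear_scale[OF linear_Ad])
  qed
  moreover have "W \<subseteq> V" "W \<noteq> {0}" using x by (auto simp: W_def)
  ultimately have "W = V" using irr by (auto simp: irreducible_module_def)
  then have scalar: "C Y = c *\<^sub>R Y" if "Y \<in> V" for Y using that by (auto simp: W_def)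
  have "casimir_constant G K V = c"
    unfolding casimir_constant_def
    by (rule the_equality) (use scalar x in auto)
  then show ?thesis using scalar[OF X] by simp
qed

lemma casimir_scalar_iff_casimir_constants_eq:
  assumes two: "two_isotropy_summands G K m1 m2"
    and k1: "\<And>U X. U \<in> k \<Longrightarrow> X \<in> m1 \<Longrightarrow> bracket U X \<in> m1"
    and k2: "\<And>U X. U \<in> k \<Longrightarrow> X \<in> m2 \<Longrightarrow> bracket U X \<in> m2"
  shows "(\<exists>c. \<forall>X\<in>m. C X = c *\<^sub>R X) \<longleftrightarrow> casimir_constant G K m1 = casimir_constant G K m2"
proof -
  have irr: "irreducible_module K m1" "irreducible_module K m2"
    and m: "m = {X + Y |X Y. X \<in> m1 \<and> Y \<in> m2}"
    using two by (auto simp: two_isotropy_summands_def)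
  have zero: "0 \<in> m1" "0 \<in> m2"
    using irr by (auto simp: irreducible_module_def submodule_def subspace_0)
  have sub: "m1 \<subseteq> m" "m2 \<subseteq> m"
    unfolding m using zero by force+
  have C1: "C X = casimir_constant G K m1 *\<^sub>R X" if "X \<in> m1" for X
    by (rule casimir_constant[OF irr(1) sub(1) _ that]) (rule k1)
  have C2: "C X = casimir_constant G K m2 *\<^sub>R X" if "X \<in> m2" for X
    by (rule casimir_constant[OF irr(2) sub(2) _ that]) (rule k2)
  obtain x1 x2 where x: "x1 \<in> m1" "x1 \<noteq> 0" "x2 \<in> m2" "x2 \<noteq> 0"
    using irr zero by (auto simp: irreducible_module_def)
  show ?thesis
  proof
    assume "\<exists>c. \<forall>X\<in>m. C X = c *\<^sub>R X"
    then obtain c where c: "\<And>X. X \<in> m \<Longrightarrow> C X = c *\<^sub>R X" by blast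
    have "c = casimir_constant G K m1" using c[of x1] C1[OF x(1)] x sub by auto
    moreover have "c = casimir_constant G K m2" using c[of x2] C2[OF x(3)] x sub by auto
    ultimately show "casimir_constant G K m1 = casimir_constant G K m2" by simp
  next
    assume eq: "casimir_constant G K m1 = casimir_constant G K m2"
    have "C X = casimir_constant G K m1 *\<^sub>R X" if X: "X \<in> m" for X
    proof -
      obtain Y Z where YZ: "X = Y + Z" "Y \<in> m1" "Z \<in> m2" using X unfolding m by blast
      then have "C X = C Y + C Z"
        using linear_map_on_add[OF linear_map_on_casimir[of UNIV]] by simp
      also have "\<dots> = casimir_constant G K m1 *\<^sub>R X"
        using C1[OF YZ(2)] C2[OF YZ(3)] YZ(1) eq by (simp add: scaleR_add_right)
      finally show ?thesis .
    qed
    then show "\<exists>c. \<forall>X\<in>m. C X = c *\<^sub>R X" by blast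
  qed
qed

end

theorem theorem5p14:
  fixes G K m1 m2 :: "(real ^ 'n::finite ^ 'n) set"
  assumes "matrix_group G" and "compact G" and "connected G"
    and "semisimple_lie (lie_algebra G)"
    and "matrix_group K" and "K \<subseteq> G" and "closed K" and "connected K"
    and "two_isotropy_summands G K m1 m2"
    and "dim (tangent_space G K) \<ge> 3"
    and "\<And>X Y. X \<in> lie_algebra K \<Longrightarrow> Y \<in> m1 \<Longrightarrow> bracket X Y \<in> m1"
    and "\<And>X Y. X \<in> lie_algebra K \<Longrightarrow> Y \<in> m2 \<Longrightarrow> bracket X Y \<in> m2"
    and "\<And>X Y. X \<in> m1 \<Longrightarrow> Y \<in> m1 \<Longrightarrow> bracket X Y \<in> {U + V | U V. U \<in> lie_algebra K \<and> V \<in> m2}"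
    and "\<And>X Y. X \<in> m1 \<Longrightarrow> Y \<in> m2 \<Longrightarrow> bracket X Y \<in> m1"
    and "\<And>X Y. X \<in> m2 \<Longrightarrow> Y \<in> m2 \<Longrightarrow> bracket X Y \<in> lie_algebra K"
  shows "((\<exists>X\<in>tangent_space G K. \<exists>Y\<in>tangent_space G K. bracket_m G K X Y \<noteq> 0) \<longrightarrow>
           (\<forall>s\<in>{0, 2}.
              (nabla_einstein G K (neg_killing G) (nabla_s G K s) \<and>
               skew_torsion G K (neg_killing G) (nabla_s G K s) \<and>
               nonzero_torsion G K (nabla_s G K s))
              \<longleftrightarrow> invariant_einstein_metric G K (neg_killing G))) \<and>
         (invariant_einstein_metric G K (neg_killing G) \<longleftrightarrow>
           casimir_constant G K m1 = casimir_constant G K m2)"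
proof -
  obtain S where S: "transpose S = S" "\<And>x. x \<noteq> 0 \<Longrightarrow> x \<bullet> (S *v x) > 0"
    "\<And>A. A \<in> G \<Longrightarrow> transpose A ** S ** A = S"
    using invariant_positive_definite_form_exists[OF assms(1,2)] by blast
  interpret killing_homogeneous_space G S K
    by unfold_locales (use assms S in auto)
  have "dim m \<noteq> 0" using assms(10) by linarith
  then have einstein: "nabla_einstein G K B (nabla_s G K s) \<longleftrightarrow> invariant_einstein_metric G K B" for s
    unfolding invariant_einstein_metric_iff by (rule nabla_einstein_iff)
  have torsion: "nonzero_torsion G K (nabla_s G K s)"
    if "\<exists>X\<in>m. \<exists>Y\<in>m. br_m X Y \<noteq> 0" "s \<in> {0, 2}" for s
    using that by (auto simp: nonzero_torsion_def torsion_nabla_s)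
  show ?thesis
    using einstein torsion skew_torsion_nabla_s invariant_einstein_metric_iff
      casimir_scalar_iff_casimir_constants_eq[OF assms(9,11,12)]
    by blast
qed

end
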